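(* Let $B_{c_0}$ be the open unit ball of the complex Banach space $c_0$. The set of all functions $f\in\mathcal{H}^\infty(B_{c_0})$ such that $Cl(f,x)$ contains a disk for every $x\in B_{c_0}$ is strongly $\mathfrak{c}$-algebrable (as a subset of the algebra $\mathcal{H}^\infty(B_{c_0})$) and contains, up to the zero function, an almost isometric copy of $\ell_1$. In particular, this set is spaceable.
   Context: $\mathcal{H}^\infty(B_{c_0})$ is the Banach algebra of all bounded holomorphic functions $f:B_{c_0}\to\mathbb{C}$ with the supremum norm. With $E=c_0$ regarded as a subspace of $E^{**}=\ell_\infty$, for $f\in\mathcal{H}^\infty(B_{c_0})$ and $z$ in the closed unit ball of $E^{**}$ the cluster set is $$Cl(f,z)=\{\lambda\in\mathbb{C}: \text{there is a net } (x_\alpha)\subset B_{c_0} \text{ with } x_\alpha\to z \text{ in the topology } w(E^{**},E^* ) \text{ and } f(x_\alpha)\to\lambda\}.$$ A disk means a disk in $\mathbb{C}$ of positive radius (its center and radius may depend on $f$ and on the point). $\mathfrak{c}$ is the cardinality of the continuum. A set $M\subset \mathcal{H}^\infty(B_{c_0})$ contains, up to the zero function, an almost isometric copy of $\ell_1$ if for every $\varepsilon>0$ there is a linear map $T:\ell_1\to\mathcal{H}^\infty(B_{c_0})$ with $\|\beta\|_1\le\|T\beta\|\le(1+\varepsilon)\|\beta\|_1$ for all $\beta\in\ell_1$ and $T(\ell_1)\subset M\cup\{0\}$. A subset $G=\{x_i:i\in I\}$ of a complex commutative algebra $\mathcal{A}$ is algebraically independent if for every $n\in\mathbb{N}$,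 every polynomial $Q\in\mathbb{C}[z_1,\dots,z_n]$ and all distinct indices $i_1,\dots,i_n\in I$, $Q(x_{i_1},\dots,x_{i_n})=0$ implies $Q=0$. If $\mathcal{A}$ is an algebra of complex-valued functions on a set and $\kappa$ is a cardinal, a subset $M\subset\mathcal{A}$ is strongly $\kappa$-algebrable if there is a sub-algebra $\mathcal{B}$ of $\mathcal{A}$ generated by an infinite algebraically independent set of generators of cardinality $\kappa$ and such that $\mathcal{B}\subset M\cup\{0\}$. Here the generated sub-algebra is not required to contain the unit: it consists of all values $Q(x_{i_1},\dots,x_{i_n})$ of polynomials $Q$ without constant term at generators. A subset $M$ of a topological vector space $X$ is spaceable if there is an infinite-dimensional closed vector subspace $Y$ of $X$ with $Y\subset M\cup\{0\}$. *)

theory Defs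
  imports
    "HOL-Analysis.Analysis"
    "HOL-Library.Poly_Mapping"
    "HOL-Library.Equipollence"
begin

section \<open>Complex vector spaces and algebras\<close>

class scaleC =
  fixes scaleC :: "complex \<Rightarrow> 'a \<Rightarrow> 'a" (infixr \<open>*\<^sub>C\<close> 75)

class complex_vector = scaleC + real_vector +
  assumes scaleC_add_right: "a *\<^sub>C (x + y) = a *\<^sub>C x + a *\<^sub>C y"
    and scaleC_add_left: "(a + b) *\<^sub>C x = a *\<^sub>C x + b *\<^sub>C x"
    and scaleC_scaleC: "a *\<^sub>C (b *\<^sub>C x) = (a * b) *\<^sub>C x"
    and scaleC_one: "1 *\<^sub>C x = x"
    and scaleR_eq_scaleC: "r *\<^sub>R x = complex_of_real r *\<^sub>C x"

class complex_normed_vector = complex_vector + real_normed_vector +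
  assumes norm_scaleC: "norm (a *\<^sub>C x) = norm a * norm x"

class complex_comm_algebra_1 = complex_vector + comm_ring_1 +
  assumes mult_scaleC_left: "(a *\<^sub>C x) * y = a *\<^sub>C (x * y)"

global_interpretation complex_vector: vector_space "scaleC :: complex \<Rightarrow> 'a \<Rightarrow> 'a::complex_vector"
  by standard (simp_all add: scaleC_add_right scaleC_add_left scaleC_scaleC scaleC_one)

instantiation complex :: complex_normed_vector
begin

definition scaleC_complex :: "complex \<Rightarrow> complex \<Rightarrow> complex"
  where "scaleC_complex = (*)"

instance
  by standard (simp_all add: scaleC_complex_def algebra_simps norm_mult scaleR_conv_of_real)

end

lemma bounded_scaleC_range:
  fixes f :: "'i \<Rightarrow> 'a::complex_normed_vector"
  shows "bounded (range f) \<Longrightarrow> bounded (range (\<lambda>x. a *\<^sub>C f x))"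
  unfolding bounded_iff
proof clarsimp
  fix B assume "\<forall>x. norm (f x) \<le> B"
  then have "\<forall>x. norm (a *\<^sub>C f x) \<le> norm a * B"
    by (simp add: norm_scaleC mult_left_mono)
  then show "\<exists>B. \<forall>x. norm (a *\<^sub>C f x) \<le> B" ..
qed

lemma bounded_linear_scaleC_right: "bounded_linear (\<lambda>x::'a::complex_normed_vector. a *\<^sub>C x)"
proof (rule bounded_linear_intro[where K = "norm a"])
  fix r and x :: 'a
  show "a *\<^sub>C (r *\<^sub>R x) = r *\<^sub>R (a *\<^sub>C x)"
    by (simp add: scaleR_eq_scaleC scaleC_scaleC mult.commute)
qed (simp_all add: scaleC_add_right norm_scaleC mult.commute)

lemma scaleC_cont:
  fixes f :: "'a::topological_space \<Rightarrow> 'b::complex_normed_vector"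
  shows "f \<in> bcontfun \<Longrightarrow> (\<lambda>x. a *\<^sub>C f x) \<in> bcontfun"
  unfolding bcontfun_def
  by (auto intro: bounded_linear.continuous_on[OF bounded_linear_scaleC_right] bounded_scaleC_range)

instantiation bcontfun :: (topological_space, complex_normed_vector) complex_normed_vector
begin

definition scaleC_bcontfun :: "complex \<Rightarrow> ('a \<Rightarrow>\<^sub>C 'b) \<Rightarrow> 'a \<Rightarrow>\<^sub>C 'b"
  where "scaleC_bcontfun a f = Bcontfun (\<lambda>x. a *\<^sub>C apply_bcontfun f x)"

lemma apply_scaleC_bcontfun [simp]:
  "apply_bcontfun (a *\<^sub>C f) = (\<lambda>x. a *\<^sub>C apply_bcontfun (f :: 'a \<Rightarrow>\<^sub>C 'b) x)"
  unfolding scaleC_bcontfun_def by (simp add: Bcontfun_inverse[OF scaleC_cont[OF apply_bcontfun]])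

instance
proof
  fix a b :: complex and r :: real and f g :: "'a \<Rightarrow>\<^sub>C 'b"
  show "a *\<^sub>C (f + g) = a *\<^sub>C f + a *\<^sub>C g" "(a + b) *\<^sub>C f = a *\<^sub>C f + b *\<^sub>C f"
    "a *\<^sub>C b *\<^sub>C f = (a * b) *\<^sub>C f" "1 *\<^sub>C f = f" "r *\<^sub>R f = complex_of_real r *\<^sub>C f"
    by (auto intro!: bcontfun_eqI
        simp: scaleC_add_right scaleC_add_left scaleC_scaleC scaleC_one scaleR_eq_scaleC)
  have le: "norm (c *\<^sub>C h) \<le> norm c * norm h" for c and h :: "'a \<Rightarrow>\<^sub>C 'b"
    by (rule norm_bound) (simp add: norm_scaleC norm_bounded mult_left_mono)
  show "norm (a *\<^sub>C f) = norm a * norm f"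
  proof (cases "a = 0")
    case True
    then have "a *\<^sub>C f = 0"
      by (auto intro!: bcontfun_eqI)
    then show ?thesis using True by simp
  next
    case False
    have "f = inverse a *\<^sub>C (a *\<^sub>C f)"
      using False by (auto intro!: bcontfun_eqI simp: scaleC_scaleC scaleC_one)
    then have "norm f \<le> norm (inverse a) * norm (a *\<^sub>C f)"
      using le by metis
    then have "norm a * norm f \<le> norm (a *\<^sub>C f)"
      using False by (simp add: norm_inverse norm_divide field_simps)
    then show ?thesis using le[of a f] by simp
  qed
qed

end

definition bounded_clinear :: "('a::complex_normed_vector \<Rightarrow> 'b::complex_normed_vector) \<Rightarrow> bool"
  where "bounded_clinear f \<longleftrightarrow> bounded_linear f \<and> (\<forall>c x. f (c *\<^sub>C x) = c *\<^sub>C f x)"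

text \<open>Holomorphy on an open set: complex Frechet differentiability at each of its points.\<close>

definition holomorphic_map_on ::
    "('a::complex_normed_vector \<Rightarrow> 'b::complex_normed_vector) \<Rightarrow> 'a set \<Rightarrow> bool"
  where "holomorphic_map_on f S \<longleftrightarrow>
    (\<forall>x\<in>S. \<exists>D. bounded_clinear D \<and> (f has_derivative D) (at x))"


section \<open>The sequence spaces\<close>

text \<open>Every function on the discrete space \<^typ>\<open>nat\<close> is continuous, so \<^typ>\<open>nat \<Rightarrow>\<^sub>C complex\<close> is the
  space of bounded sequences with the supremum norm.\<close>

type_synonym linf = "nat \<Rightarrow>\<^sub>C complex"

typedef c0 = "{x :: linf. apply_bcontfun x \<longlonglongrightarrow> 0}"
  morphisms linf_of_c0 Abs_c0
  by (rule exI[of _ 0]) simp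

setup_lifting type_definition_c0

instantiation c0 :: complex_normed_vector
begin

lift_definition zero_c0 :: c0 is 0 by simp
lift_definition plus_c0 :: "c0 \<Rightarrow> c0 \<Rightarrow> c0" is "(+)" by (auto intro: tendsto_add_zero)
lift_definition minus_c0 :: "c0 \<Rightarrow> c0 \<Rightarrow> c0" is "(-)" by (auto intro: tendsto_eq_intros)
lift_definition uminus_c0 :: "c0 \<Rightarrow> c0" is "uminus" by (auto intro: tendsto_eq_intros)
lift_definition scaleR_c0 :: "real \<Rightarrow> c0 \<Rightarrow> c0" is "scaleR" by (auto intro: tendsto_eq_intros)
lift_definition scaleC_c0 :: "complex \<Rightarrow> c0 \<Rightarrow> c0" is "scaleC"
  by (auto simp: scaleC_complex_def intro: tendsto_mult_right_zero)
lift_definition norm_c0 :: "c0 \<Rightarrow> real" is norm .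
lift_definition dist_c0 :: "c0 \<Rightarrow> c0 \<Rightarrow> real" is dist .

definition sgn_c0 :: "c0 \<Rightarrow> c0" where "sgn_c0 x = inverse (norm x) *\<^sub>R x"
definition uniformity_c0 :: "(c0 \<times> c0) filter"
  where "uniformity_c0 = (INF e\<in>{0 <..}. principal {(x, y). dist x y < e})"
definition open_c0 :: "c0 set \<Rightarrow> bool"
  where "open_c0 S = (\<forall>x\<in>S. \<forall>\<^sub>F (x', y) in uniformity. x' = x \<longrightarrow> y \<in> S)"

instance
proof
  fix x y z :: c0 and a b :: real and c d :: complex
  show "x + y + z = x + (y + z)" by transfer (simp add: add.assoc)
  show "x + y = y + x" by transfer (simp add: add.commute)
  show "0 + x = x" by transfer simp
  show "- x + x = 0" by transfer simp
  show "x - y = x + - y" by transfer simp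
  show "a *\<^sub>R (x + y) = a *\<^sub>R x + a *\<^sub>R y" by transfer (simp add: scaleR_add_right)
  show "(a + b) *\<^sub>R x = a *\<^sub>R x + b *\<^sub>R x" by transfer (simp add: scaleR_add_left)
  show "a *\<^sub>R b *\<^sub>R x = (a * b) *\<^sub>R x" by transfer simp
  show "1 *\<^sub>R x = x" by transfer simp
  show "c *\<^sub>C (x + y) = c *\<^sub>C x + c *\<^sub>C y" by transfer (rule scaleC_add_right)
  show "(c + d) *\<^sub>C x = c *\<^sub>C x + d *\<^sub>C x" by transfer (rule scaleC_add_left)
  show "c *\<^sub>C d *\<^sub>C x = (c * d) *\<^sub>C x" by transfer (rule scaleC_scaleC)
  show "1 *\<^sub>C x = x" by transfer (rule scaleC_one)
  show "a *\<^sub>R x = complex_of_real a *\<^sub>C x" by transfer (rule scaleR_eq_scaleC)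
  show "dist x y = norm (x - y)" by transfer (rule dist_norm)
  show "norm x = 0 \<longleftrightarrow> x = 0" by transfer simp
  show "norm (x + y) \<le> norm x + norm y" by transfer (rule norm_triangle_ineq)
  show "norm (a *\<^sub>R x) = \<bar>a\<bar> * norm x" by transfer simp
  show "norm (c *\<^sub>C x) = norm c * norm x" by transfer (rule norm_scaleC)
qed (rule sgn_c0_def uniformity_c0_def open_c0_def)+

end

definition ell1 :: "(nat \<Rightarrow> complex) set"
  where "ell1 = {\<beta>. summable (\<lambda>n. norm (\<beta> n))}"

definition ell1_norm :: "(nat \<Rightarrow> complex) \<Rightarrow> real"
  where "ell1_norm \<beta> = suminf (\<lambda>n. norm (\<beta> n))"


section \<open>The weak-star topology on the bidual and cluster sets\<close>

lift_definition c0_unit :: "nat \<Rightarrow> c0"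
  is "\<lambda>k. Bcontfun (\<lambda>n. if n = k then 1 else 0)"
proof -
  fix k :: nat
  have "(\<lambda>n. if n = k then 1 else 0 :: complex) \<in> bcontfun"
    by (rule bcontfun_normI[where b = 1]) auto
  moreover have "(\<lambda>n. if n = k then 1 else 0 :: complex) \<longlonglongrightarrow> 0"
    by (rule tendsto_eventually) (auto intro: eventually_sequentiallyI[of "Suc k"])
  ultimately show "apply_bcontfun (Bcontfun (\<lambda>n. if n = k then 1 else 0 :: complex)) \<longlonglongrightarrow> 0"
    by (simp only: Bcontfun_inverse)
qed

text \<open>The canonical identification of the bidual of \<^typ>\<open>c0\<close> with the bounded sequences: \<open>z\<close> acts on
  a functional \<open>\<phi>\<close> by summing \<open>z n\<close> times \<open>\<phi> (c0_unit n)\<close>. By lemma \<open>bidual_pairing_c0\<close> this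
  extends evaluation of \<open>\<phi>\<close> at the elements of \<^typ>\<open>c0\<close>.\<close>

definition bidual_pairing :: "linf \<Rightarrow> (c0 \<Rightarrow> complex) \<Rightarrow> complex"
  where "bidual_pairing z \<phi> = suminf (\<lambda>n. apply_bcontfun z n * \<phi> (c0_unit n))"

text \<open>The topology \<open>w(E\<^sup>*\<^sup>*, E\<^sup>*)\<close>, as the initial topology of the functionals in \<open>E\<^sup>*\<close>.\<close>

definition weak_star_linf :: "linf topology"
  where "weak_star_linf =
    topology_generated_by {{z. bidual_pairing z \<phi> \<in> U} | \<phi> U. bounded_clinear \<phi> \<and> open U}"

lemma bidual_pairing_c0:
  assumes "bounded_clinear \<phi>"
  shows "bidual_pairing (linf_of_c0 x) \<phi> = \<phi> x"
proof -
  define a where "a = apply_bcontfun (linf_of_c0 x)"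
  have a0: "a \<longlonglongrightarrow> 0"
    using linf_of_c0[of x] by (simp add: a_def)
  interpret bounded_linear \<phi>
    using assms by (simp add: bounded_clinear_def)
  have unit: "apply_bcontfun (linf_of_c0 (c0_unit k)) n = (if n = k then 1 else 0)" for k n
  proof -
    have "(\<lambda>n. if n = k then 1 else 0 :: complex) \<in> bcontfun"
      by (rule bcontfun_normI[where b = 1]) auto
    then show ?thesis
      by (simp add: c0_unit.rep_eq Bcontfun_inverse)
  qed
  have coord: "apply_bcontfun (linf_of_c0 (\<Sum>k<N. a k *\<^sub>C c0_unit k)) n = (if n < N then a n else 0)" for N n
    by (induction N) (auto simp: zero_c0.rep_eq plus_c0.rep_eq scaleC_c0.rep_eq unit
        scaleC_complex_def less_Suc_eq)
  have "(\<lambda>k. a k *\<^sub>C c0_unit k) sums x"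
    unfolding sums_def
  proof (rule LIMSEQ_I)
    fix r :: real assume "0 < r"
    then obtain N0 where N0: "\<And>n. n \<ge> N0 \<Longrightarrow> norm (a n) < r / 2"
      using LIMSEQ_D[OF a0, of "r / 2"] by auto
    have "norm ((\<Sum>k<N. a k *\<^sub>C c0_unit k) - x) < r" if "N \<ge> N0" for N
    proof -
      have "norm (linf_of_c0 ((\<Sum>k<N. a k *\<^sub>C c0_unit k) - x)) \<le> r / 2"
        using N0 \<open>0 < r\<close> that
        by (intro norm_bound) (auto simp: minus_c0.rep_eq coord a_def[symmetric] less_imp_le)
      then show ?thesis
        using \<open>0 < r\<close> by (simp add: norm_c0.rep_eq)
    qed
    then show "\<exists>no. \<forall>n\<ge>no. norm ((\<Sum>k<n. a k *\<^sub>C c0_unit k) - x) < r"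
      by blast
  qed
  then have "(\<lambda>k. \<phi> (a k *\<^sub>C c0_unit k)) sums \<phi> x"
    by (rule sums)
  then show ?thesis
    using assms
    by (simp add: bidual_pairing_def bounded_clinear_def scaleC_complex_def a_def sums_unique[symmetric])
qed


section \<open>Bounded holomorphic functions on the open unit ball\<close>

text \<open>Elements are represented by functions on all of \<^typ>\<open>c0\<close> that vanish off the open unit ball, so
  that equality is equality on the ball; in particular the unit is the indicator of the ball.\<close>

typedef hinf = "{f :: c0 \<Rightarrow> complex. holomorphic_map_on f (ball 0 1) \<and> bounded (f ` ball 0 1) \<and>
    (\<forall>x. x \<notin> ball 0 1 \<longrightarrow> f x = 0)}"
  morphisms hinf_fun Abs_hinf
proof (rule exI[of _ "\<lambda>_. 0"])
  have "bounded_clinear (\<lambda>_::c0. 0::complex)"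
    by (simp add: bounded_clinear_def scaleC_complex_def)
  then show "(\<lambda>_. 0) \<in> {f :: c0 \<Rightarrow> complex. holomorphic_map_on f (ball 0 1) \<and>
      bounded (f ` ball 0 1) \<and> (\<forall>x. x \<notin> ball 0 1 \<longrightarrow> f x = 0)}"
    by (auto simp: holomorphic_map_on_def image_constant_conv)
qed

setup_lifting type_definition_hinf

lemma holomorphic_map_on_const: "holomorphic_map_on (\<lambda>_::'a::complex_normed_vector. c::complex) S"
  unfolding holomorphic_map_on_def
  by (auto intro!: exI[of _ "\<lambda>_. 0"] simp: bounded_clinear_def scaleC_complex_def)

lemma holomorphic_map_on_add:
  fixes f g :: "'a::complex_normed_vector \<Rightarrow> complex"
  assumes "holomorphic_map_on f S" "holomorphic_map_on g S"
  shows "holomorphic_map_on (\<lambda>x. f x + g x) S"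
  unfolding holomorphic_map_on_def
proof
  fix x assume "x \<in> S"
  then obtain D E where D: "bounded_clinear D" "(f has_derivative D) (at x)"
    and E: "bounded_clinear E" "(g has_derivative E) (at x)"
    using assms unfolding holomorphic_map_on_def by blast
  have "bounded_clinear (\<lambda>h. D h + E h)"
    using D(1) E(1) unfolding bounded_clinear_def
    by (auto intro: bounded_linear_add simp: scaleC_add_right)
  then show "\<exists>D. bounded_clinear D \<and> ((\<lambda>x. f x + g x) has_derivative D) (at x)"
    using D(2) E(2) by (blast intro: has_derivative_add)
qed

lemma holomorphic_map_on_mult:
  fixes f g :: "'a::complex_normed_vector \<Rightarrow> complex"
  assumes "holomorphic_map_on f S" "holomorphic_map_on g S"
  shows "holomorphic_map_on (\<lambda>x. f x * g x) S"
  unfolding holomorphic_map_on_def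
proof
  fix x assume "x \<in> S"
  then obtain D E where D: "bounded_clinear D" "(f has_derivative D) (at x)"
    and E: "bounded_clinear E" "(g has_derivative E) (at x)"
    using assms unfolding holomorphic_map_on_def by blast
  have "bounded_linear (\<lambda>h. f x * E h + D h * g x)"
    using D(1) E(1) unfolding bounded_clinear_def
    by (intro bounded_linear_add bounded_linear_const_mult bounded_linear_mult_const) auto
  then have "bounded_clinear (\<lambda>h. f x * E h + D h * g x)"
    using D(1) E(1) unfolding bounded_clinear_def
    by (auto simp: scaleC_complex_def algebra_simps)
  then show "\<exists>D. bounded_clinear D \<and> ((\<lambda>x. f x * g x) has_derivative D) (at x)"
    using has_derivative_mult[OF D(2) E(2)] by blast
qed

lemma holomorphic_map_on_cong:
  assumes "open S" "\<And>x. x \<in> S \<Longrightarrow> f x = g x" "holomorphic_map_on f S"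
  shows "holomorphic_map_on g S"
  using assms unfolding holomorphic_map_on_def
  by (meson has_derivative_transform_within_open)

instantiation hinf :: complex_normed_vector
begin

lift_definition zero_hinf :: hinf is "\<lambda>_. 0"
  by (auto simp: holomorphic_map_on_const image_constant_conv)

lift_definition plus_hinf :: "hinf \<Rightarrow> hinf \<Rightarrow> hinf" is "\<lambda>f g x. f x + g x"
  by (auto intro: holomorphic_map_on_add bounded_plus_comp)

lift_definition scaleC_hinf :: "complex \<Rightarrow> hinf \<Rightarrow> hinf" is "\<lambda>c f x. c * f x"
proof (intro conjI)
  fix c :: complex and f :: "c0 \<Rightarrow> complex"
  assume f: "holomorphic_map_on f (ball 0 1) \<and> bounded (f ` ball 0 1) \<and>
    (\<forall>x. x \<notin> ball 0 1 \<longrightarrow> f x = 0)"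
  then show "holomorphic_map_on (\<lambda>x. c * f x) (ball 0 1)"
    by (auto intro: holomorphic_map_on_mult holomorphic_map_on_const)
  show "bounded ((\<lambda>x. c * f x) ` ball 0 1)"
    using f bounded_linear_image[OF _ bounded_linear_mult_right, of "f ` ball 0 1" c]
    by (auto simp: image_image)
  show "\<forall>x. x \<notin> ball 0 1 \<longrightarrow> c * f x = 0"
    using f by auto
qed

definition uminus_hinf :: "hinf \<Rightarrow> hinf" where "uminus_hinf f = (-1) *\<^sub>C f"
definition minus_hinf :: "hinf \<Rightarrow> hinf \<Rightarrow> hinf" where "minus_hinf f g = f + (-1) *\<^sub>C g"
definition scaleR_hinf :: "real \<Rightarrow> hinf \<Rightarrow> hinf" where "scaleR_hinf r f = complex_of_real r *\<^sub>C f"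

definition norm_hinf :: "hinf \<Rightarrow> real" where "norm_hinf f = (SUP x\<in>ball 0 1. norm (hinf_fun f x))"
definition dist_hinf :: "hinf \<Rightarrow> hinf \<Rightarrow> real" where "dist_hinf f g = norm (f - g)"
definition sgn_hinf :: "hinf \<Rightarrow> hinf" where "sgn_hinf f = inverse (norm f) *\<^sub>R f"
definition uniformity_hinf :: "(hinf \<times> hinf) filter"
  where "uniformity_hinf = (INF e\<in>{0 <..}. principal {(x, y). dist x y < e})"
definition open_hinf :: "hinf set \<Rightarrow> bool"
  where "open_hinf S = (\<forall>x\<in>S. \<forall>\<^sub>F (x', y) in uniformity. x' = x \<longrightarrow> y \<in> S)"

lemma norm_hinf_upper: "norm (hinf_fun f x) \<le> norm f"
proof -
  have bdd: "bdd_above ((\<lambda>x. norm (hinf_fun f x)) ` ball 0 1)"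
    using hinf_fun[of f] by (auto simp: bounded_iff bdd_above_def)
  have le: "norm (hinf_fun f x) \<le> norm f" if "x \<in> ball 0 1" for x
    unfolding norm_hinf_def by (rule cSUP_upper[OF that bdd])
  have "0 \<le> norm f"
    using order_trans[OF norm_ge_zero le[of 0]] by simp
  then show ?thesis
    using le[of x] hinf_fun[of f] by (cases "x \<in> ball 0 1") auto
qed

lemma norm_hinf_least: "(\<And>x. x \<in> ball 0 1 \<Longrightarrow> norm (hinf_fun f x) \<le> B) \<Longrightarrow> norm f \<le> B"
  unfolding norm_hinf_def by (rule cSUP_least) auto

instance
proof
  fix f g h :: hinf and r s :: real and c d :: complex
  show "f + g + h = f + (g + h)" by transfer (simp add: add.assoc)
  show "f + g = g + f" by transfer (simp add: add.commute)
  show "0 + f = f" by transfer simp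
  show "- f + f = 0" unfolding uminus_hinf_def by transfer simp
  show "f - g = f + - g" unfolding uminus_hinf_def minus_hinf_def ..
  show "c *\<^sub>C (f + g) = c *\<^sub>C f + c *\<^sub>C g" by transfer (simp add: algebra_simps)
  show "(c + d) *\<^sub>C f = c *\<^sub>C f + d *\<^sub>C f" by transfer (simp add: algebra_simps)
  show "c *\<^sub>C d *\<^sub>C f = (c * d) *\<^sub>C f" by transfer (simp add: algebra_simps)
  show "1 *\<^sub>C f = f" by transfer simp
  show "r *\<^sub>R f = complex_of_real r *\<^sub>C f" by (rule scaleR_hinf_def)
  show "r *\<^sub>R (f + g) = r *\<^sub>R f + r *\<^sub>R g"
    unfolding scaleR_hinf_def by transfer (simp add: algebra_simps)
  show "(r + s) *\<^sub>R f = r *\<^sub>R f + s *\<^sub>R f"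
    unfolding scaleR_hinf_def by transfer (simp add: algebra_simps)
  show "r *\<^sub>R s *\<^sub>R f = (r * s) *\<^sub>R f"
    unfolding scaleR_hinf_def by transfer (simp add: algebra_simps)
  show "1 *\<^sub>R f = f"
    unfolding scaleR_hinf_def by transfer simp
  show "dist f g = norm (f - g)" by (rule dist_hinf_def)
  have zero: "norm (0::hinf) = 0"
    by (simp add: norm_hinf_def zero_hinf.rep_eq)
  show "norm f = 0 \<longleftrightarrow> f = 0"
  proof
    assume "norm f = 0"
    then have "hinf_fun f x = 0" for x
      using norm_hinf_upper[of f x] by simp
    then show "f = 0"
      by (simp add: hinf_fun_inject[symmetric] zero_hinf.rep_eq fun_eq_iff)
  qed (simp add: zero)
  show "norm (f + g) \<le> norm f + norm g"
    by (rule norm_hinf_least)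
      (auto simp: plus_hinf.rep_eq intro!: norm_triangle_le add_mono norm_hinf_upper)
  have le: "norm (c *\<^sub>C f) \<le> norm c * norm f" for c and f :: hinf
    by (rule norm_hinf_least) (auto simp: scaleC_hinf.rep_eq norm_mult norm_hinf_upper mult_left_mono)
  show scaleC: "norm (c *\<^sub>C f) = norm c * norm f" for c
  proof (cases "c = 0")
    case True
    then have "c *\<^sub>C f = 0" by transfer simp
    then show ?thesis using True zero by simp
  next
    case False
    have "f = inverse c *\<^sub>C (c *\<^sub>C f)"
      using False by transfer (simp add: fun_eq_iff)
    then have "norm f \<le> norm (inverse c) * norm (c *\<^sub>C f)"
      using le by metis
    then have "norm c * norm f \<le> norm (c *\<^sub>C f)"
      using False by (simp add: norm_inverse norm_divide field_simps)
    then show ?thesis using le[of c f] by simp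
  qed
  show "norm (r *\<^sub>R f) = \<bar>r\<bar> * norm f"
    by (simp add: scaleR_hinf_def scaleC)
qed (rule sgn_hinf_def uniformity_hinf_def open_hinf_def)+

end

instantiation hinf :: "{complex_comm_algebra_1, real_normed_algebra_1}"
begin

lift_definition one_hinf :: hinf is "\<lambda>x. if x \<in> ball 0 1 then 1 else 0"
proof (intro conjI)
  show "holomorphic_map_on (\<lambda>x::c0. if x \<in> ball 0 1 then 1 else 0 :: complex) (ball 0 1)"
    by (rule holomorphic_map_on_cong[OF open_ball _ holomorphic_map_on_const[of 1]]) auto
  show "bounded ((\<lambda>x::c0. if x \<in> ball 0 1 then 1 else 0 :: complex) ` ball 0 1)"
    by (rule boundedI[of _ 1]) auto
qed auto

lift_definition times_hinf :: "hinf \<Rightarrow> hinf \<Rightarrow> hinf" is "\<lambda>f g x. f x * g x"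
proof (intro conjI)
  fix f g :: "c0 \<Rightarrow> complex"
  assume fg: "holomorphic_map_on f (ball 0 1) \<and> bounded (f ` ball 0 1) \<and>
      (\<forall>x. x \<notin> ball 0 1 \<longrightarrow> f x = 0)"
    "holomorphic_map_on g (ball 0 1) \<and> bounded (g ` ball 0 1) \<and>
      (\<forall>x. x \<notin> ball 0 1 \<longrightarrow> g x = 0)"
  then show "holomorphic_map_on (\<lambda>x. f x * g x) (ball 0 1)"
    by (auto intro: holomorphic_map_on_mult)
  obtain A B where A: "\<forall>x\<in>ball 0 1. norm (f x) \<le> A" and B: "\<forall>x\<in>ball 0 1. norm (g x) \<le> B"
    using fg by (auto simp: bounded_iff)
  show "bounded ((\<lambda>x. f x * g x) ` ball 0 1)"
  proof (rule boundedI[of _ "A * B"])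
    fix y assume "y \<in> (\<lambda>x. f x * g x) ` ball 0 1"
    then obtain x where x: "x \<in> ball 0 1" "y = f x * g x" by auto
    have "0 \<le> A" using A x order_trans[OF norm_ge_zero] by blast
    then show "norm y \<le> A * B"
      using A B x by (simp only: norm_mult) (rule mult_mono, auto)
  qed
  show "\<forall>x. x \<notin> ball 0 1 \<longrightarrow> f x * g x = 0"
    using fg by auto
qed

instance
proof
  fix f g h :: hinf and r :: real and c :: complex
  show "f * g * h = f * (g * h)" by transfer (simp add: mult.assoc)
  show "f * g = g * f" by transfer (simp add: mult.commute)
  show "1 * f = f" by transfer (auto simp: fun_eq_iff)
  show "f * 1 = f" by transfer (auto simp: fun_eq_iff)
  show "(f + g) * h = f * h + g * h" by transfer (simp add: algebra_simps)
  show "f * (g + h) = f * g + f * h" by transfer (simp add: algebra_simps)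
  show "(0::hinf) \<noteq> 1"
  proof
    assume "(0::hinf) = 1"
    then have "hinf_fun 0 0 = hinf_fun 1 0" by simp
    then show False by (simp add: zero_hinf.rep_eq one_hinf.rep_eq)
  qed
  show "(c *\<^sub>C f) * g = c *\<^sub>C (f * g)" by transfer (simp add: mult.assoc)
  show "r *\<^sub>R f * g = r *\<^sub>R (f * g)" unfolding scaleR_hinf_def by transfer (simp add: mult.assoc)
  show "f * r *\<^sub>R g = r *\<^sub>R (f * g)" unfolding scaleR_hinf_def by transfer (simp add: mult.left_commute)
  show "norm (f * g) \<le> norm f * norm g"
  proof (rule norm_hinf_least)
    fix x :: c0
    have "norm (hinf_fun f x) * norm (hinf_fun g x) \<le> norm f * norm g"
      by (intro mult_mono norm_hinf_upper norm_ge_zero)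
    then show "norm (hinf_fun (f * g) x) \<le> norm f * norm g"
      by (simp add: times_hinf.rep_eq norm_mult)
  qed
  show "norm (1::hinf) = 1"
  proof (rule antisym)
    show "norm (1::hinf) \<le> 1" by (rule norm_hinf_least) (simp add: one_hinf.rep_eq)
    show "1 \<le> norm (1::hinf)" using norm_hinf_upper[of 1 0] by (simp add: one_hinf.rep_eq)
  qed
qed

end

text \<open>A net in the ball enters only through its image filter of tails, and every proper filter
  containing the ball arises in this way.\<close>

definition cluster_set :: "hinf \<Rightarrow> linf \<Rightarrow> complex set"
  where "cluster_set f z = {l. \<exists>F :: c0 filter. F \<noteq> bot \<and> (\<forall>\<^sub>F x in F. x \<in> ball 0 1) \<and>
    limitin weak_star_linf linf_of_c0 z F \<and> (hinf_fun f \<longlongrightarrow> l) F}"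

definition contains_disk :: "complex set \<Rightarrow> bool"
  where "contains_disk S \<longleftrightarrow> (\<exists>a r. 0 < r \<and> ball a r \<subseteq> S)"


section \<open>Algebrability, copies of the space of absolutely summable sequences, spaceability\<close>

text \<open>Complex polynomials in countably many variables: a monomial is a finitely supported exponent
  function, and a polynomial maps finitely many monomials to their nonzero coefficients. The
  coefficient of the zero exponent is the constant term.\<close>

type_synonym cpoly = "(nat \<Rightarrow>\<^sub>0 nat) \<Rightarrow>\<^sub>0 complex"

definition cpolys :: "nat \<Rightarrow> cpoly set"
  where "cpolys n = {Q. \<forall>m\<in>Poly_Mapping.keys Q. Poly_Mapping.keys m \<subseteq> {..<n}}"

definition cpoly_eval :: "cpoly \<Rightarrow> (nat \<Rightarrow> 'a::complex_comm_algebra_1) \<Rightarrow> 'a"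
  where "cpoly_eval Q x = (\<Sum>m\<in>Poly_Mapping.keys Q.
    Poly_Mapping.lookup Q m *\<^sub>C (\<Prod>i\<in>Poly_Mapping.keys m. x i ^ Poly_Mapping.lookup m i))"

definition algebraically_independent :: "'a::complex_comm_algebra_1 set \<Rightarrow> bool"
  where "algebraically_independent G \<longleftrightarrow>
    (\<forall>n. \<forall>Q\<in>cpolys n. \<forall>x. inj_on x {..<n} \<longrightarrow> x ` {..<n} \<subseteq> G \<longrightarrow> cpoly_eval Q x = 0 \<longrightarrow> Q = 0)"

definition generated_subalgebra :: "'a::complex_comm_algebra_1 set \<Rightarrow> 'a set"
  where "generated_subalgebra G =
    {cpoly_eval Q x | n Q x. Q \<in> cpolys n \<and> Poly_Mapping.lookup Q 0 = 0 \<and> x ` {..<n} \<subseteq> G}"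

text \<open>The cardinal is given as that of a set \<open>K\<close>.\<close>

definition strongly_algebrable :: "'k set \<Rightarrow> 'a::complex_comm_algebra_1 set \<Rightarrow> bool"
  where "strongly_algebrable K M \<longleftrightarrow>
    (\<exists>G. infinite G \<and> G \<approx> K \<and> algebraically_independent G \<and> generated_subalgebra G \<subseteq> M \<union> {0})"

definition contains_almost_isometric_ell1 :: "'a::complex_normed_vector set \<Rightarrow> bool"
  where "contains_almost_isometric_ell1 M \<longleftrightarrow>
    (\<forall>\<epsilon>>0. \<exists>T :: (nat \<Rightarrow> complex) \<Rightarrow> 'a.
      (\<forall>\<beta>\<in>ell1. \<forall>\<gamma>\<in>ell1. T (\<lambda>n. \<beta> n + \<gamma> n) = T \<beta> + T \<gamma>) \<and>
      (\<forall>\<beta>\<in>ell1. \<forall>c. T (\<lambda>n. c * \<beta> n) = c *\<^sub>C T \<beta>) \<and>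
      (\<forall>\<beta>\<in>ell1. ell1_norm \<beta> \<le> norm (T \<beta>) \<and> norm (T \<beta>) \<le> (1 + \<epsilon>) * ell1_norm \<beta>) \<and>
      T ` ell1 \<subseteq> M \<union> {0})"

definition spaceable :: "'a::complex_normed_vector set \<Rightarrow> bool"
  where "spaceable M \<longleftrightarrow>
    (\<exists>Y. complex_vector.subspace Y \<and> closed Y \<and> \<not> (\<exists>B. finite B \<and> Y \<subseteq> complex_vector.span B) \<and>
      Y \<subseteq> M \<union> {0})"

end

theory Submission
  imports Defs "HOL-Complex_Analysis.Conformal_Mappings"
begin

text \<open>Everything is transported from one complex variable. The function \<open>cayley_sum\<close> sends a point
  \<open>x\<close> of the ball to the sum over \<open>n\<close> of \<open>2 powr - (n + 1)\<close> times the Cayley transform of its coordinate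
  \<open>n\<close>. It is a holomorphic map of the ball onto the right half-plane. A change of a single
  coordinate with large index hardly matters for the weak topology, but it can add to the value of
  the function any prescribed point of the half-plane, because the small weight is compensated by
  the unbounded Cayley transform. Consequently, for a holomorphic function \<open>g\<close> on the half-plane the
  cluster set of \<open>g \<circ> cayley_sum\<close> at \<open>x\<close> contains the image under \<open>g\<close> of the half-plane translated by
  \<open>cayley_sum x\<close> (lemma \<open>cluster_set_pullback\<close>), and if \<open>g\<close> is not constant, that image is open.

  So all bounded compositions with holomorphic \<open>g\<close> that tend to zero along the positive real axis
  belong to the set in question, apart from the zero function (lemma \<open>vanishing_pullback_disk\<close>).
  These compositions form a closed subspace, as the supremum norm of \<open>g \<circ> cayley_sum\<close> over the ball
  is the supremum norm of \<open>g\<close> over the half-plane (lemma \<open>closed_vanishing_pullbacks\<close>). All three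
  claims are obtained inside this subspace.

  For the algebra take the functions \<open>exp (- (s powr \<alpha>))\<close> with \<open>\<alpha>\<close> between zero and one. They are
  bounded, and their monomials are exponentials of sums of powers. Since distinct such sums differ by
  a function that diverges at infinity, comparison of the speeds of decay shows that the monomials
  are linearly independent (lemma \<open>exponential_sum_coefficients_zero\<close>). In particular
  the generators are linearly independent, so that the subspace has infinite dimension.

  For the copy of the absolutely summable sequences take the series of the functions
  \<open>exp (- (N ^ j * s))\<close> with coefficients \<open>\<beta> j\<close>. On the imaginary axis the phases of finitely many of its
  terms can be prescribed up to an error of order \<open>1 / N\<close> (lemma \<open>lacunary_phases\<close>), so that the
  supremum of the series is nearly the sum of the moduli of its coefficients.\<close>


section \<open>Coordinates and weak convergence in the space of null sequences\<close>

definition coord :: "c0 \<Rightarrow> nat \<Rightarrow> complex"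
  where "coord x = apply_bcontfun (linf_of_c0 x)"

lemma coord_add: "coord (x + y) n = coord x n + coord y n"
  by (simp add: coord_def plus_c0.rep_eq)

lemma coord_diff: "coord (x - y) n = coord x n - coord y n"
  by (simp add: coord_def minus_c0.rep_eq)

lemma coord_zero: "coord 0 n = 0"
  by (simp add: coord_def zero_c0.rep_eq)

lemma coord_scaleC: "coord (c *\<^sub>C x) n = c * coord x n"
  by (simp add: coord_def scaleC_c0.rep_eq scaleC_complex_def)

lemma coord_sum: "coord (sum f A) n = (\<Sum>k\<in>A. coord (f k) n)"
  by (induction A rule: infinite_finite_induct) (auto simp: coord_zero coord_add)

lemma coord_unit: "coord (c0_unit k) n = (if n = k then 1 else 0)"
proof -
  have "(\<lambda>n. if n = k then 1 else 0 :: complex) \<in> bcontfun"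
    by (rule bcontfun_normI[where b = 1]) auto
  then show ?thesis
    by (simp add: coord_def c0_unit.rep_eq Bcontfun_inverse)
qed

lemma coord_finite_combination:
  "finite A \<Longrightarrow> coord (\<Sum>k\<in>A. u k *\<^sub>C c0_unit k) n = (if n \<in> A then u n else 0)"
  by (simp add: coord_sum coord_scaleC coord_unit if_distrib[of "(*) _"] cong: if_cong)

lemma norm_coord_le: "norm (coord x n) \<le> norm x"
  by (simp add: coord_def norm_c0.rep_eq norm_bounded)

lemma norm_c0_le: "(\<And>n. norm (coord x n) \<le> B) \<Longrightarrow> norm x \<le> B"
  by (simp add: coord_def norm_c0.rep_eq norm_bound)

text \<open>A functional on null sequences is given by an absolutely summable sequence: the functional, applied
  to a finite combination of unit vectors whose unimodular coefficients undo its phases, bounds the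
  partial sums of the moduli.\<close>

lemma unit_functional_null:
  fixes \<phi> :: "c0 \<Rightarrow> complex"
  assumes "bounded_clinear \<phi>"
  shows "(\<lambda>n. \<phi> (c0_unit n)) \<longlonglongrightarrow> 0"
proof -
  interpret bounded_linear \<phi>
    using assms by (simp add: bounded_clinear_def)
  obtain K where K: "\<And>x. norm (\<phi> x) \<le> norm x * K" and "0 \<le> K"
    using nonneg_bounded by blast
  define u where "u k = cnj (sgn (\<phi> (c0_unit k)))" for k
  have u_mult: "u k * \<phi> (c0_unit k) = complex_of_real (norm (\<phi> (c0_unit k)))" for k
    by (cases "\<phi> (c0_unit k) = 0")
      (simp_all add: u_def sgn_eq complex_norm_square[symmetric] power2_eq_square mult.commute)
  have u_le: "norm (u k) \<le> 1" for k
    by (simp add: u_def norm_sgn)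
  have "(\<Sum>k<N. norm (\<phi> (c0_unit k))) \<le> K" for N
  proof -
    let ?x = "\<Sum>k<N. u k *\<^sub>C c0_unit k"
    have "norm ?x \<le> 1"
      by (rule norm_c0_le) (simp add: coord_finite_combination u_le)
    then have "norm (\<phi> ?x) \<le> K"
      using K[of ?x] mult_right_mono[of "norm ?x" 1 K] \<open>0 \<le> K\<close> by simp
    moreover have "\<phi> ?x = complex_of_real (\<Sum>k<N. norm (\<phi> (c0_unit k)))"
      using assms by (simp add: sum bounded_clinear_def scaleC_complex_def u_mult)
    ultimately show ?thesis
      by (simp only: norm_of_real)
  qed
  then have "summable (\<lambda>k. norm (\<phi> (c0_unit k)))"
    by (intro bounded_imp_summable[where B = K]) (simp_all only: norm_ge_zero flip: lessThan_Suc_atMost)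
  then show ?thesis
    using summable_LIMSEQ_zero tendsto_norm_zero_iff by blast
qed

text \<open>On the image of \<^typ>\<open>c0\<close> the pairing is evaluation, so there weak-star convergence can be tested
  on one functional at a time.\<close>

lemma limitin_weak_star_c0:
  assumes "\<And>\<phi> :: c0 \<Rightarrow> complex. bounded_clinear \<phi> \<Longrightarrow> ((\<lambda>i. \<phi> (y i)) \<longlongrightarrow> \<phi> x) F"
  shows "limitin weak_star_linf (\<lambda>i. linf_of_c0 (y i)) (linf_of_c0 x) F"
proof -
  let ?S = "{{z. bidual_pairing z \<phi> \<in> U} | \<phi> U. bounded_clinear \<phi> \<and> open U}"
  have ev: "linf_of_c0 x \<in> W \<longrightarrow> (\<forall>\<^sub>F i in F. linf_of_c0 (y i) \<in> W)"
    if "generate_topology_on ?S W" for W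
    using that
  proof induction
    case (UN K)
    show ?case
    proof
      assume "linf_of_c0 x \<in> \<Union> K"
      then obtain k where k: "k \<in> K" "linf_of_c0 x \<in> k" by blast
      then have "\<forall>\<^sub>F i in F. linf_of_c0 (y i) \<in> k"
        using UN by blast
      then show "\<forall>\<^sub>F i in F. linf_of_c0 (y i) \<in> \<Union> K"
        by (rule eventually_mono) (use k in blast)
    qed
  next
    case (Basis W)
    then obtain \<phi> U where "W = {z. bidual_pairing z \<phi> \<in> U}" "bounded_clinear \<phi>" "open U"
      by blast
    then show ?case
      using topological_tendstoD[OF assms[of \<phi>], of U] by (auto simp: bidual_pairing_c0)
  qed (auto elim: eventually_elim2)
  have "bounded_clinear (\<lambda>_::c0. 0::complex)"
    by (simp add: bounded_clinear_def scaleC_complex_def)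
  then have "UNIV \<in> ?S"
    by (intro CollectI exI[of _ "\<lambda>_. 0"] exI[of _ UNIV]) auto
  then have "topspace weak_star_linf = UNIV"
    unfolding weak_star_linf_def topology_generated_by_topspace by blast
  then show ?thesis
    using ev unfolding limitin_def weak_star_linf_def openin_topology_generated_by_iff by auto
qed

definition set_coord :: "c0 \<Rightarrow> nat \<Rightarrow> complex \<Rightarrow> c0"
  where "set_coord x n t = x + (t - coord x n) *\<^sub>C c0_unit n"

lemma coord_set_coord: "coord (set_coord x n t) k = (if k = n then t else coord x k)"
  by (simp add: set_coord_def coord_add coord_scaleC coord_unit)

lemma set_coord_in_ball:
  assumes "x \<in> ball 0 1" "norm t < 1"
  shows "set_coord x n t \<in> ball 0 1"
proof -
  have "norm (set_coord x n t) \<le> max (norm x) (norm t)"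
    by (rule norm_c0_le) (auto simp: coord_set_coord le_max_iff_disj norm_coord_le)
  then show ?thesis using assms by auto
qed

text \<open>The source of all cluster points: moving one coordinate, however far inside the disk, is invisible
  in the weak topology once the index of that coordinate tends to infinity.\<close>

lemma set_coord_tendsto_weakly:
  fixes \<phi> :: "c0 \<Rightarrow> complex"
  assumes "\<And>n. norm (t n) \<le> 1" "bounded_clinear \<phi>"
  shows "(\<lambda>n. \<phi> (set_coord x n (t n))) \<longlonglongrightarrow> \<phi> x"
proof -
  interpret bounded_linear \<phi>
    using assms by (simp add: bounded_clinear_def)
  have "(\<lambda>n. (t n - coord x n) * \<phi> (c0_unit n)) \<longlonglongrightarrow> 0"
  proof (rule Lim_null_comparison)
    have "norm (t n - coord x n) \<le> 1 + norm x" for n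
      using norm_triangle_ineq4[of "t n" "coord x n"] assms(1)[of n] norm_coord_le[of x n] by linarith
    then show "\<forall>\<^sub>F n in sequentially.
        norm ((t n - coord x n) * \<phi> (c0_unit n)) \<le> (1 + norm x) * norm (\<phi> (c0_unit n))"
      by (intro always_eventually allI) (simp add: norm_mult mult_right_mono)
    show "(\<lambda>n. (1 + norm x) * norm (\<phi> (c0_unit n))) \<longlonglongrightarrow> 0"
      using unit_functional_null[OF assms(2)] by (intro tendsto_mult_right_zero tendsto_norm_zero)
  qed
  then have "(\<lambda>n. \<phi> x + (t n - coord x n) * \<phi> (c0_unit n)) \<longlonglongrightarrow> \<phi> x + 0"
    by (intro tendsto_intros)
  then show ?thesis
    using assms(2) by (simp add: set_coord_def add bounded_clinear_def scaleC_complex_def)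
qed


section \<open>A holomorphic map of the ball onto the right half-plane\<close>

abbreviation halfplane :: "complex set"
  where "halfplane \<equiv> {s. 0 < Re s}"

text \<open>The Cayley transform, a conformal map of the unit disk onto the right half-plane.\<close>

definition cayley :: "complex \<Rightarrow> complex"
  where "cayley z = (1 + z) / (1 - z)"

lemma Re_cayley:
  assumes "norm z < 1"
  shows "0 < Re (cayley z)"
proof -
  have "z \<noteq> 1" using assms by auto
  then have "cayley z = (1 + z) * cnj (1 - z) / complex_of_real ((norm (1 - z))\<^sup>2)"
    by (simp only: cayley_def complex_div_cnj[of "1 + z" "1 - z"] of_real_power)
  moreover have "(Re z)\<^sup>2 + (Im z)\<^sup>2 < 1"
    using assms by (metis cmod_power2 norm_ge_zero power2_less_imp_less power_one abs_square_less_1 abs_norm_cancel)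
  then have "0 < Re ((1 + z) * cnj (1 - z))"
    by (simp add: algebra_simps power2_eq_square)
  ultimately show ?thesis
    using \<open>z \<noteq> 1\<close> by (simp only: Re_divide_of_real) (auto intro!: divide_pos_pos)
qed

lemma cayley_surj:
  assumes "0 < Re s"
  obtains z where "norm z < 1" "cayley z = s"
proof
  have "s + 1 \<noteq> 0"
    using assms by (auto simp: complex_eq_iff)
  have "norm (s - 1) < norm (s + 1)"
    using assms by (simp add: cmod_def power2_eq_square algebra_simps)
  then show "norm ((s - 1) / (s + 1)) < 1"
    by (simp add: norm_divide divide_simps)
  have "1 - (s - 1) / (s + 1) = 2 / (s + 1)" "1 + (s - 1) / (s + 1) = 2 * s / (s + 1)"
    using \<open>s + 1 \<noteq> 0\<close> by (simp_all add: field_simps)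
  then show "cayley ((s - 1) / (s + 1)) = s"
    using \<open>s + 1 \<noteq> 0\<close> by (simp add: cayley_def)
qed

lemma norm_one_minus_ge: "norm z \<le> r \<Longrightarrow> 1 - r \<le> norm (1 - z)" for z :: complex
  using norm_triangle_ineq2[of 1 z] by simp

lemma norm_cayley_le:
  assumes "norm z \<le> r" "r < 1"
  shows "norm (cayley z) \<le> 2 / (1 - r)"
  unfolding cayley_def norm_divide
proof (rule frac_le)
  show "norm (1 + z) \<le> 2"
    using norm_triangle_ineq[of 1 z] assms by simp
qed (use assms norm_one_minus_ge in auto)

text \<open>A second-order remainder bound that is uniform on smaller disks. Being quadratic in the increment,
  it survives summation over all coordinates and gives Frechet differentiability of the map below.\<close>

lemma cayley_taylor:
  assumes "norm z \<le> r" "norm w \<le> r" "r < 1"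
  shows "norm (cayley w - cayley z - 2 / (1 - z)\<^sup>2 * (w - z)) \<le> 2 / (1 - r) ^ 3 * (norm (w - z))\<^sup>2"
proof -
  have ne: "z \<noteq> 1" "w \<noteq> 1" using assms by auto
  have "cayley w - cayley z - 2 / (1 - z)\<^sup>2 * (w - z) = 2 * (w - z)\<^sup>2 / ((1 - z)\<^sup>2 * (1 - w))"
    using ne by (simp add: cayley_def divide_simps) algebra
  moreover have "(1 - r) ^ 3 \<le> norm ((1 - z)\<^sup>2 * (1 - w))"
    unfolding norm_mult norm_power power3_eq_cube power2_eq_square
    using assms norm_one_minus_ge by (intro mult_mono) auto
  ultimately show ?thesis
    using assms by (simp add: norm_divide norm_mult norm_power frac_le)
qed

text \<open>The weights make the series converge on the whole open ball, where the coordinates of a point stay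
  in a smaller disk, while each single coordinate still takes every value of the half-plane. They add
  up to one, so that the origin is sent to one.\<close>

definition cayley_sum :: "c0 \<Rightarrow> complex"
  where "cayley_sum x = suminf (\<lambda>n. (1/2) ^ Suc n * cayley (coord x n))"

lemma summable_half_powers_mult:
  fixes a :: "nat \<Rightarrow> complex"
  assumes "\<And>n. norm (a n) \<le> B"
  shows "summable (\<lambda>n. (1/2) ^ Suc n * a n)"
proof (rule summable_comparison_test')
  show "summable (\<lambda>n. (1/2) ^ Suc n * B)"
    by (intro summable_mult2 summable_Suc_iff[THEN iffD2] summable_geometric) auto
  show "norm ((1/2) ^ Suc n * a n) \<le> (1/2) ^ Suc n * B" for n
    by (simp add: norm_mult norm_power norm_divide assms)
qed

lemma cayley_sum_sums:
  assumes "x \<in> ball 0 1"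
  shows "(\<lambda>n. (1/2) ^ Suc n * cayley (coord x n)) sums cayley_sum x"
  unfolding cayley_sum_def
  by (intro summable_sums summable_half_powers_mult[where B = "2 / (1 - norm x)"])
     (use assms norm_coord_le in \<open>auto intro!: norm_cayley_le\<close>)

lemma cayley_sum_in_halfplane:
  assumes "x \<in> ball 0 1"
  shows "cayley_sum x \<in> halfplane"
proof -
  have sums: "(\<lambda>n. Re ((1/2) ^ Suc n * cayley (coord x n))) sums Re (cayley_sum x)"
    using cayley_sum_sums[OF assms] by (rule sums_Re)
  have "Re ((1/2) ^ Suc n * cayley (coord x n)) = (1/2) ^ Suc n * Re (cayley (coord x n))" for n
  proof -
    have "(1/2 :: complex) ^ Suc n = complex_of_real ((1/2) ^ Suc n)"
      by simp
    then show ?thesis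
      by (metis Re_complex_of_real Im_complex_of_real times_complex.sel(1) diff_zero mult_zero_left)
  qed
  moreover have "0 < Re (cayley (coord x n))" for n
    using assms norm_coord_le[of x n] by (intro Re_cayley) auto
  ultimately have "0 < Re ((1/2) ^ Suc n * cayley (coord x n))" for n
    by simp
  then show ?thesis
    using suminf_pos[OF sums_summable[OF sums]] sums_unique[OF sums] by simp
qed

lemma cayley_sum_set_coord:
  assumes "x \<in> ball 0 1" "norm t < 1"
  shows "cayley_sum (set_coord x n t)
    = cayley_sum x + (1/2) ^ Suc n * (cayley t - cayley (coord x n))"
proof -
  have "(\<lambda>k. (1/2) ^ Suc k * cayley (coord (set_coord x n t) k) - (1/2) ^ Suc k * cayley (coord x k))
      sums (cayley_sum (set_coord x n t) - cayley_sum x)"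
    by (intro sums_diff cayley_sum_sums set_coord_in_ball assms)
  moreover have "(\<lambda>k. (1/2) ^ Suc k * cayley (coord (set_coord x n t) k) - (1/2) ^ Suc k * cayley (coord x k))
      = (\<lambda>k. if k = n then (1/2) ^ Suc k * (cayley t - cayley (coord x k)) else 0)"
    by (rule ext) (simp add: coord_set_coord right_diff_distrib)
  ultimately have "cayley_sum (set_coord x n t) - cayley_sum x
      = (1/2) ^ Suc n * (cayley t - cayley (coord x n))"
    using sums_unique2[OF _ sums_single[of n "\<lambda>k. (1/2) ^ Suc k * (cayley t - cayley (coord x k))"]]
    by (simp only:)
  then show ?thesis
    by (simp only: diff_eq_eq add.commute)
qed

text \<open>Give the coordinate with index \<open>n\<close> the value whose Cayley transform is \<open>2 ^ Suc n * s\<close>: the weight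
  cancels this power of two, so the new summand is exactly \<open>s\<close>, whereas the summand that it replaces
  is a term of a convergent series and tends to zero.\<close>

lemma cayley_sum_cluster:
  assumes "x \<in> ball 0 1" "0 < Re s"
  obtains y where "\<And>n. y n \<in> ball 0 1"
    "limitin weak_star_linf (\<lambda>n. linf_of_c0 (y n)) (linf_of_c0 x) sequentially"
    "(\<lambda>n. cayley_sum (y n)) \<longlonglongrightarrow> cayley_sum x + s"
proof -
  have "\<exists>t. norm t < 1 \<and> cayley t = 2 ^ Suc n * s" for n
  proof -
    have "Re (2 ^ Suc n * s) = 2 ^ Suc n * Re s"
      by (metis Re_complex_of_real Im_complex_of_real of_real_numeral of_real_power
          times_complex.simps(1) diff_zero mult_zero_left)
    then show ?thesis
      using assms(2) by (metis cayley_surj zero_less_mult_iff zero_less_numeral zero_less_power)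
  qed
  then obtain t where t: "\<And>n. norm (t n) < 1" "\<And>n. cayley (t n) = 2 ^ Suc n * s"
    by metis
  show ?thesis
  proof
    show "set_coord x n (t n) \<in> ball 0 1" for n
      by (intro set_coord_in_ball assms t)
    show "limitin weak_star_linf (\<lambda>n. linf_of_c0 (set_coord x n (t n))) (linf_of_c0 x) sequentially"
      by (intro limitin_weak_star_c0 set_coord_tendsto_weakly less_imp_le t)
    have "(\<lambda>n. cayley_sum x + (s - (1/2) ^ Suc n * cayley (coord x n))) \<longlonglongrightarrow> cayley_sum x + (s - 0)"
      by (intro tendsto_intros summable_LIMSEQ_zero[OF sums_summable[OF cayley_sum_sums[OF assms(1)]]])
    moreover have "cayley_sum (set_coord x n (t n))
        = cayley_sum x + (s - (1/2) ^ Suc n * cayley (coord x n))" for n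
      using assms t by (simp add: cayley_sum_set_coord right_diff_distrib power_divide)
    ultimately show "(\<lambda>n. cayley_sum (set_coord x n (t n))) \<longlonglongrightarrow> cayley_sum x + s"
      by simp
  qed
qed

text \<open>A point with \<open>N\<close> equal coordinates \<open>z\<close> and zeros afterwards is sent to \<open>(1 - q) * cayley z + q\<close>, where
  \<open>q\<close> is the total weight of the remaining coordinates. For large \<open>N\<close> the real part of \<open>s - q\<close> is
  positive and the equation for \<open>z\<close> can be solved.\<close>

lemma cayley_sum_surj:
  assumes "0 < Re s"
  obtains x where "x \<in> ball 0 1" "cayley_sum x = s"
proof -
  obtain N0 where "(1/2) ^ N0 < Re s"
    using real_arch_pow_inv[OF assms, of "1/2"] by auto
  moreover have "(1/2) ^ Suc N0 \<le> (1/2 :: real) ^ N0"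
    by (rule power_decreasing) auto
  ultimately have N: "(1/2) ^ Suc N0 < Re s"
    by linarith
  define N where "N = Suc N0"
  define q :: real where "q = (1/2) ^ N"
  have q: "0 < q" "q < Re s" "q < 1"
    using N power_Suc_less_one[of "1/2::real" N0] by (auto simp: q_def N_def)
  have "0 < Re ((s - of_real q) / of_real (1 - q))"
    using q by (simp only: Re_divide_of_real) simp
  then obtain z where z: "norm z < 1" "cayley z = (s - of_real q) / of_real (1 - q)"
    by (rule cayley_surj)
  define x where "x = (\<Sum>k<N. z *\<^sub>C c0_unit k)"
  have coord_x: "coord x n = (if n < N then z else 0)" for n
    by (simp add: x_def coord_finite_combination)
  have "norm x \<le> norm z"
    by (rule norm_c0_le) (simp add: coord_x)
  then have x: "x \<in> ball 0 1"
    using z by simp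
  have geo: "(\<lambda>n. (1/2) ^ Suc n :: complex) sums 1"
    using sums_mult[OF geometric_sums[of "1/2::complex"], of "1/2"] by simp
  have fin: "(\<Sum>n<N. (1/2) ^ Suc n :: complex) = 1 - of_real q"
  proof -
    have "(\<Sum>n<m. (1/2) ^ Suc n :: complex) = 1 - (1/2) ^ m" for m
    proof (induction m)
      case (Suc m)
      show ?case
        by (simp only: sum.lessThan_Suc Suc) simp
    qed simp
    then show ?thesis by (simp add: q_def)
  qed
  have "(\<lambda>n. (1/2) ^ Suc n + (if n \<in> {..<N} then (1/2) ^ Suc n * (cayley z - 1) else 0))
      sums (1 + (\<Sum>n<N. (1/2) ^ Suc n * (cayley z - 1)))"
    by (intro sums_add geo sums_If_finite_set) simp
  moreover have "(\<lambda>n. (1/2) ^ Suc n + (if n \<in> {..<N} then (1/2) ^ Suc n * (cayley z - 1) else 0))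
      = (\<lambda>n. (1/2) ^ Suc n * cayley (coord x n))"
    by (rule ext) (simp add: coord_x cayley_def[of 0] right_diff_distrib)
  ultimately have "cayley_sum x = 1 + (\<Sum>n<N. (1/2) ^ Suc n * (cayley z - 1))"
    using sums_unique2[OF cayley_sum_sums[OF x]] by (simp only:)
  also have "\<dots> = 1 + (1 - of_real q) * (cayley z - 1)"
    using fin by (simp only: sum_distrib_right[symmetric])
  also have "\<dots> = s"
  proof -
    have "complex_of_real (1 - q) \<noteq> 0"
      using q by (simp only: of_real_eq_0_iff)
    then have "cayley z * complex_of_real (1 - q) = s - of_real q"
      by (rule nonzero_eq_divide_eq[THEN iffD1, OF _ z(2)])
    then show ?thesis
      by (simp add: algebra_simps)
  qed
  finally show ?thesis
    using that x by blast
qed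

lemma cayley_sum_differentiable:
  assumes "x \<in> ball 0 1"
  obtains D where "bounded_clinear D" "(cayley_sum has_derivative D) (at x)"
proof
  \<comment> \<open>A radius strictly between the norm of the point and one: the Taylor bound is uniform on this ball.\<close>
  define r where "r = (1 + norm x) / 2"
  have r: "norm x < r" "r < 1" "0 < r"
    using assms by (auto simp: r_def intro: add_pos_nonneg)
  define b where "b n = 2 / (1 - coord x n)\<^sup>2" for n
  define D where "D h = suminf (\<lambda>n. (1/2) ^ Suc n * (b n * coord h n))" for h
  define B where "B = 2 / (1 - r)\<^sup>2"
  define C where "C = 2 / (1 - r) ^ 3"
  have b_le: "norm (b n) \<le> B" for n
  proof -
    have "1 - r \<le> norm (1 - coord x n)"
      using norm_coord_le[of x n] r by (intro norm_one_minus_ge) linarith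
    then show ?thesis
      unfolding b_def B_def norm_divide norm_power
      using r by (intro frac_le power_mono) auto
  qed
  have "0 \<le> B" "0 \<le> C" using r by (auto simp: B_def C_def)
  have half_sums: "(\<lambda>n. (1/2) ^ Suc n * K) sums K" for K :: real
    using sums_mult2[OF power_half_series, of K] by simp
  have weighted_le: "norm l \<le> K"
    if "\<And>n. norm (a n) \<le> K" "(\<lambda>n. (1/2) ^ Suc n * a n) sums l" for a :: "nat \<Rightarrow> complex" and K l
  proof -
    have "norm ((1/2) ^ Suc n * a n) \<le> (1/2) ^ Suc n * K" for n
      by (simp add: norm_mult norm_power norm_divide that(1))
    then show ?thesis
      using norm_suminf_le[OF _ sums_summable[OF half_sums[of K]], of "\<lambda>n. (1/2) ^ Suc n * a n"]
        sums_unique[OF half_sums[of K]] sums_unique[OF that(2)] by metis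
  qed
  have bh_le: "norm (b n * coord h n) \<le> B * norm h" for n h
    unfolding norm_mult using b_le norm_coord_le \<open>0 \<le> B\<close> by (intro mult_mono) auto
  have D_sums: "(\<lambda>n. (1/2) ^ Suc n * (b n * coord h n)) sums D h" for h
    unfolding D_def by (intro summable_sums summable_half_powers_mult[OF bh_le])
  have D_scaleC: "D (c *\<^sub>C h) = c *\<^sub>C D h" for c h
    using sums_unique2[OF D_sums[of "c *\<^sub>C h"], of "c * D h"] sums_mult[OF D_sums[of h], of c]
    by (simp add: coord_scaleC scaleC_complex_def mult.left_commute)
  have "bounded_linear D"
  proof (rule bounded_linear_intro[where K = B])
    show "D (h + k) = D h + D k" for h k
      using sums_unique2[OF D_sums[of "h + k"], of "D h + D k"] sums_add[OF D_sums[of h] D_sums[of k]]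
      by (simp add: coord_add distrib_left)
    show "D (c *\<^sub>R h) = c *\<^sub>R D h" for c h
      by (simp add: scaleR_eq_scaleC D_scaleC)
    show "norm (D h) \<le> norm h * B" for h
      using weighted_le[OF bh_le D_sums] by (simp add: mult.commute)
  qed
  then show "bounded_clinear D"
    by (simp add: bounded_clinear_def D_scaleC)
  have taylor: "norm (cayley_sum y - cayley_sum x - D (y - x)) \<le> C * (norm (y - x))\<^sup>2"
    if "norm y \<le> r" for y
  proof (rule weighted_le)
    show "(\<lambda>n. (1/2) ^ Suc n *
        (cayley (coord y n) - cayley (coord x n) - 2 / (1 - coord x n)\<^sup>2 * (coord y n - coord x n)))
        sums (cayley_sum y - cayley_sum x - D (y - x))"
      using sums_diff[OF sums_diff[OF cayley_sum_sums[of y] cayley_sum_sums[of x]] D_sums[of "y - x"]]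
        that r assms by (simp add: coord_diff b_def right_diff_distrib)
    fix n
    have "norm (cayley (coord y n) - cayley (coord x n) - 2 / (1 - coord x n)\<^sup>2 * (coord y n - coord x n))
        \<le> C * (norm (coord (y - x) n))\<^sup>2"
      unfolding C_def coord_diff
      using norm_coord_le[of x n] norm_coord_le[of y n] that r by (intro cayley_taylor) auto
    also have "\<dots> \<le> C * (norm (y - x))\<^sup>2"
      using \<open>0 \<le> C\<close> norm_coord_le by (intro mult_left_mono power_mono) auto
    finally show "norm (cayley (coord y n) - cayley (coord x n)
        - 2 / (1 - coord x n)\<^sup>2 * (coord y n - coord x n)) \<le> C * (norm (y - x))\<^sup>2" .
  qed
  show "(cayley_sum has_derivative D) (at x)"
    unfolding has_derivative_at_alt
  proof (intro conjI allI impI)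
    fix e :: real assume "0 < e"
    define d where "d = min (r - norm x) (e / (C + 1))"
    have "norm (cayley_sum y - cayley_sum x - D (y - x)) \<le> e * norm (y - x)" if "norm (y - x) < d" for y
    proof -
      have "norm y \<le> r"
        using that norm_triangle_sub[of y x] by (auto simp: d_def)
      have "norm (y - x) * (C + 1) \<le> e"
        using that \<open>0 \<le> C\<close> by (simp add: d_def pos_less_divide_eq)
      then have "C * norm (y - x) \<le> e"
        using norm_ge_zero[of "y - x"] unfolding distrib_left mult.commute[of C] by linarith
      then have "C * (norm (y - x))\<^sup>2 \<le> e * norm (y - x)"
        unfolding power2_eq_square mult.assoc[symmetric] by (intro mult_right_mono) auto
      then show ?thesis
        using taylor[OF \<open>norm y \<le> r\<close>] by linarith
    qed
    moreover have "0 < d"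
      using r \<open>0 < e\<close> \<open>0 \<le> C\<close> by (simp add: d_def)
    ultimately show "\<exists>d>0. \<forall>y. norm (y - x) < d \<longrightarrow>
        norm (cayley_sum y - cayley_sum x - D (y - x)) \<le> e * norm (y - x)"
      by blast
  qed (fact \<open>bounded_linear D\<close>)
qed


section \<open>Functions pulled back from the half-plane\<close>

lemma open_halfplane: "open halfplane"
  by (rule open_halfspace_Re_gt)

lemma connected_halfplane: "connected halfplane"
  by (intro convex_connected convex_halfspace_Re_gt)

definition pullback :: "(complex \<Rightarrow> complex) \<Rightarrow> hinf"
  where "pullback g = Abs_hinf (\<lambda>x. if x \<in> ball 0 1 then g (cayley_sum x) else 0)"

lemma hinf_fun_pullback:
  assumes "g holomorphic_on halfplane" "bounded (g ` halfplane)"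
  shows "hinf_fun (pullback g) = (\<lambda>x. if x \<in> ball 0 1 then g (cayley_sum x) else 0)"
  unfolding pullback_def
proof (rule Abs_hinf_inverse, intro CollectI conjI)
  have "\<exists>D. bounded_clinear D \<and> ((\<lambda>x. g (cayley_sum x)) has_derivative D) (at x)"
    if x: "x \<in> ball 0 1" for x
  proof -
    obtain D where D: "bounded_clinear D" "(cayley_sum has_derivative D) (at x)"
      using x by (rule cayley_sum_differentiable)
    have "(g has_field_derivative deriv g (cayley_sum x)) (at (cayley_sum x))"
      using assms(1) open_halfplane cayley_sum_in_halfplane[OF x] by (rule holomorphic_derivI)
    then have "((\<lambda>x. g (cayley_sum x)) has_derivative (\<lambda>h. deriv g (cayley_sum x) * D h)) (at x)"
      using has_derivative_compose[OF D(2), of g] by (simp add: has_field_derivative_def)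
    moreover have "bounded_clinear (\<lambda>h. deriv g (cayley_sum x) * D h)"
      using D(1) by (auto simp: bounded_clinear_def scaleC_complex_def mult.left_commute
          intro: bounded_linear_const_mult)
    ultimately show ?thesis by blast
  qed
  then have "holomorphic_map_on (\<lambda>x. g (cayley_sum x)) (ball 0 1)"
    by (simp add: holomorphic_map_on_def)
  then show "holomorphic_map_on (\<lambda>x. if x \<in> ball 0 1 then g (cayley_sum x) else 0) (ball 0 1)"
    by (rule holomorphic_map_on_cong[OF open_ball, rotated]) simp
  show "bounded ((\<lambda>x. if x \<in> ball 0 1 then g (cayley_sum x) else 0) ` ball 0 1)"
    using assms(2) by (rule bounded_subset) (use cayley_sum_in_halfplane in force)
qed auto

text \<open>Along the weakly convergent sequences of lemma \<open>cayley_sum_cluster\<close> the function only sees the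
  translation of the half-plane variable.\<close>

lemma cluster_set_pullback:
  assumes f: "\<And>y. y \<in> ball 0 1 \<Longrightarrow> hinf_fun f y = g (cayley_sum y)"
    and g: "continuous_on halfplane g"
    and x: "x \<in> ball 0 1"
    and s: "s \<in> halfplane"
  shows "g (cayley_sum x + s) \<in> cluster_set f (linf_of_c0 x)"
proof -
  obtain y where y: "\<And>n. y n \<in> ball 0 1"
    and lim: "limitin weak_star_linf (\<lambda>n. linf_of_c0 (y n)) (linf_of_c0 x) sequentially"
    and to: "(\<lambda>n. cayley_sum (y n)) \<longlonglongrightarrow> cayley_sum x + s"
    using cayley_sum_cluster[OF x, of s] s by blast
  have "cayley_sum x + s \<in> halfplane"
    using cayley_sum_in_halfplane[OF x] s by simp
  then have "isCont g (cayley_sum x + s)"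
    using g open_halfplane continuous_on_eq_continuous_at by blast
  then have "(\<lambda>n. g (cayley_sum (y n))) \<longlonglongrightarrow> g (cayley_sum x + s)"
    using to by (rule isCont_tendsto_compose)
  then have "(\<lambda>n. hinf_fun f (y n)) \<longlonglongrightarrow> g (cayley_sum x + s)"
    using f y by simp
  moreover have "limitin weak_star_linf linf_of_c0 (linf_of_c0 x) (filtermap y sequentially)"
    using lim by (simp add: limitin_def eventually_filtermap)
  ultimately show ?thesis
    unfolding cluster_set_def using y
    by (intro CollectI exI[of _ "filtermap y sequentially"])
       (simp add: filtermap_bot_iff eventually_filtermap filterlim_filtermap)
qed

text \<open>The limit at infinity along the real axis serves to exclude the nonzero constants, and it is
  inherited by sums, multiples and uniform limits.\<close>

definition vanishing_pullbacks :: "hinf set"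
  where "vanishing_pullbacks = {f. \<exists>g. g holomorphic_on halfplane \<and>
    ((\<lambda>t. g (complex_of_real t)) \<longlongrightarrow> 0) at_top \<and> (\<forall>x\<in>ball 0 1. hinf_fun f x = g (cayley_sum x))}"

text \<open>The cluster set at a point contains the values of the half-plane function on a translated
  half-plane, an open set. The function is not constant, since a constant with limit zero at infinity
  would vanish; hence the open mapping theorem makes this set of values open.\<close>

lemma vanishing_pullback_disk:
  assumes "f \<in> vanishing_pullbacks" "f \<noteq> 0" "x \<in> ball 0 1"
  shows "contains_disk (cluster_set f (linf_of_c0 x))"
proof -
  obtain g where g: "g holomorphic_on halfplane"
    and lim: "((\<lambda>t. g (complex_of_real t)) \<longlongrightarrow> 0) at_top"
    and f: "\<And>x. x \<in> ball 0 1 \<Longrightarrow> hinf_fun f x = g (cayley_sum x)"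
    using assms(1) by (auto simp: vanishing_pullbacks_def)
  have "\<not> g constant_on halfplane"
  proof
    assume "g constant_on halfplane"
    then obtain c where c: "\<And>s. s \<in> halfplane \<Longrightarrow> g s = c"
      by (auto simp: constant_on_def)
    have "\<forall>\<^sub>F t in at_top. g (complex_of_real t) = c"
      using eventually_gt_at_top[of 0] by eventually_elim (simp add: c)
    then have "c = 0"
      using lim by (auto simp: tendsto_cong tendsto_const_iff)
    then have "hinf_fun f x = 0" for x
      using hinf_fun[of f] c cayley_sum_in_halfplane by (cases "x \<in> ball 0 1") (auto simp: f)
    then have "f = 0"
      by (simp add: hinf_fun_inject[symmetric] zero_hinf.rep_eq fun_eq_iff)
    then show False using assms(2) by simp
  qed
  moreover have "(+) (cayley_sum x) ` halfplane \<subseteq> halfplane"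
    using cayley_sum_in_halfplane[OF assms(3)] by auto
  ultimately have "open (g ` (+) (cayley_sum x) ` halfplane)"
    using g by (intro open_mapping_thm[where S = halfplane] open_halfplane connected_halfplane
        open_translation)
  moreover have "g (cayley_sum x + 1) \<in> g ` (+) (cayley_sum x) ` halfplane"
    by (intro imageI) simp
  ultimately obtain r where "0 < r" "ball (g (cayley_sum x + 1)) r \<subseteq> g ` (+) (cayley_sum x) ` halfplane"
    using open_contains_ball by blast
  moreover have "g ` (+) (cayley_sum x) ` halfplane \<subseteq> cluster_set f (linf_of_c0 x)"
    using cluster_set_pullback[OF f holomorphic_on_imp_continuous_on[OF g] assms(3)] by auto
  ultimately show ?thesis
    unfolding contains_disk_def by blast
qed

lemma subspace_vanishing_pullbacks: "complex_vector.subspace vanishing_pullbacks"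
proof (rule complex_vector.subspaceI)
  show "0 \<in> vanishing_pullbacks"
    unfolding vanishing_pullbacks_def by (auto intro!: exI[of _ "\<lambda>_. 0"] simp: zero_hinf.rep_eq)
next
  fix f h assume "f \<in> vanishing_pullbacks" "h \<in> vanishing_pullbacks"
  then obtain g k where
    "g holomorphic_on halfplane" "((\<lambda>t. g (complex_of_real t)) \<longlongrightarrow> 0) at_top"
    "\<forall>x\<in>ball 0 1. hinf_fun f x = g (cayley_sum x)"
    "k holomorphic_on halfplane" "((\<lambda>t. k (complex_of_real t)) \<longlongrightarrow> 0) at_top"
    "\<forall>x\<in>ball 0 1. hinf_fun h x = k (cayley_sum x)"
    unfolding vanishing_pullbacks_def by blast
  then show "f + h \<in> vanishing_pullbacks"
    unfolding vanishing_pullbacks_def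
    by (intro CollectI exI[of _ "\<lambda>s. g s + k s"])
       (auto intro: holomorphic_on_add tendsto_add_zero simp: plus_hinf.rep_eq)
next
  fix c f assume "f \<in> vanishing_pullbacks"
  then obtain g where "g holomorphic_on halfplane" "((\<lambda>t. g (complex_of_real t)) \<longlongrightarrow> 0) at_top"
    "\<forall>x\<in>ball 0 1. hinf_fun f x = g (cayley_sum x)"
    unfolding vanishing_pullbacks_def by blast
  then show "c *\<^sub>C f \<in> vanishing_pullbacks"
    unfolding vanishing_pullbacks_def
    by (intro CollectI exI[of _ "\<lambda>s. c * g s"])
       (auto intro: holomorphic_intros tendsto_mult_right_zero simp: scaleC_hinf.rep_eq)
qed

lemma norm_hinf_fun_diff_le: "norm (hinf_fun f x - hinf_fun h x) \<le> norm (f - h)"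
  using norm_hinf_upper[of "f - h" x]
  unfolding minus_hinf_def plus_hinf.rep_eq scaleC_hinf.rep_eq by simp

text \<open>As the ball is mapped onto the half-plane, the supremum norm on the ball is the supremum norm on the
  half-plane. Norm convergence is therefore uniform convergence on the half-plane, which preserves
  holomorphy and the limit at infinity.\<close>

lemma closed_vanishing_pullbacks: "closed vanishing_pullbacks"
  unfolding closed_sequential_limits
proof (intro allI impI, elim conjE)
  fix f :: "nat \<Rightarrow> hinf" and l
  assume f: "\<forall>n. f n \<in> vanishing_pullbacks" and l: "f \<longlonglongrightarrow> l"
  have "\<forall>n. \<exists>g. g holomorphic_on halfplane \<and> ((\<lambda>t. g (complex_of_real t)) \<longlongrightarrow> 0) at_top \<and>
      (\<forall>x\<in>ball 0 1. hinf_fun (f n) x = g (cayley_sum x))"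
    using f unfolding vanishing_pullbacks_def by blast
  from choice[OF this] obtain g where g: "\<And>n. g n holomorphic_on halfplane"
    and g0: "\<And>n. ((\<lambda>t. g n (complex_of_real t)) \<longlongrightarrow> 0) at_top"
    and fg: "\<And>n x. x \<in> ball 0 1 \<Longrightarrow> hinf_fun (f n) x = g n (cayley_sum x)"
    by blast
  have "\<forall>s. \<exists>x. s \<in> halfplane \<longrightarrow> x \<in> ball 0 1 \<and> cayley_sum x = s"
    using cayley_sum_surj by blast
  from choice[OF this] obtain \<sigma> where \<sigma>: "\<And>s. s \<in> halfplane \<Longrightarrow> \<sigma> s \<in> ball 0 1" "\<And>s. s \<in> halfplane \<Longrightarrow> cayley_sum (\<sigma> s) = s"
    by blast
  \<comment> \<open>A section of the map onto the half-plane, not necessarily continuous, transports the limit function.\<close>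
  define G where "G s = hinf_fun l (\<sigma> s)" for s
  have dist0: "(\<lambda>n. norm (f n - l)) \<longlonglongrightarrow> 0"
    using l by (simp add: LIM_zero tendsto_norm_zero)
  have le: "norm (g n s - G s) \<le> norm (f n - l)" if "s \<in> halfplane" for n s
    using norm_hinf_fun_diff_le[of "f n" "\<sigma> s" l] fg[OF \<sigma>(1)[OF that]] \<sigma>(2)[OF that] by (simp add: G_def)
  have unif: "uniform_limit halfplane g G sequentially"
  proof (rule uniform_limitI)
    fix e :: real assume "0 < e"
    then have "\<forall>\<^sub>F n in sequentially. norm (f n - l) < e"
      using dist0 by (rule order_tendstoD(2)[rotated])
    then show "\<forall>\<^sub>F n in sequentially. \<forall>s\<in>halfplane. dist (g n s) (G s) < e"
      by eventually_elim (auto simp: dist_norm intro: le_less_trans[OF le])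
  qed
  have "G holomorphic_on halfplane"
  proof (rule holomorphic_uniform_sequence[OF open_halfplane g])
    fix s assume "s \<in> halfplane"
    then obtain d where "0 < d" "cball s d \<subseteq> halfplane"
      using open_halfplane open_contains_cball by blast
    then show "\<exists>d>0. cball s d \<subseteq> halfplane \<and> uniform_limit (cball s d) g G sequentially"
      using uniform_limit_on_subset[OF unif] by auto
  qed
  moreover have "((\<lambda>t. G (complex_of_real t)) \<longlongrightarrow> 0) at_top"
  proof (rule tendstoI)
    fix e :: real assume "0 < e"
    then obtain n where n: "norm (f n - l) < e / 2"
      using order_tendstoD(2)[OF dist0, of "e / 2"] by (auto dest: eventually_happens)
    have "\<forall>\<^sub>F t in at_top. dist (g n (complex_of_real t)) 0 < e / 2"
      using g0 \<open>0 < e\<close> by (intro tendstoD) auto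
    then show "\<forall>\<^sub>F t in at_top. dist (G (complex_of_real t)) 0 < e"
      using eventually_gt_at_top[of 0]
    proof eventually_elim
      case (elim t)
      have "norm (g n (complex_of_real t) - G (complex_of_real t)) < e / 2"
        using le[of "complex_of_real t" n] elim n by simp
      then show ?case
        using elim norm_triangle_sub[of "G (complex_of_real t)" "g n (complex_of_real t)"]
        by (simp add: norm_minus_commute)
    qed
  qed
  moreover have "hinf_fun l x = G (cayley_sum x)" if x: "x \<in> ball 0 1" for x
  proof -
    have pointwise: "(\<lambda>n. hinf_fun (f n) y) \<longlonglongrightarrow> hinf_fun l y" for y
      by (rule LIM_zero_cancel, rule Lim_null_comparison[OF _ dist0])
         (simp add: norm_hinf_fun_diff_le)
    have "hinf_fun (f n) x = hinf_fun (f n) (\<sigma> (cayley_sum x))" for n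
      by (simp only: fg[OF x] fg[OF \<sigma>(1)[OF cayley_sum_in_halfplane[OF x]]]
          \<sigma>(2)[OF cayley_sum_in_halfplane[OF x]])
    then show ?thesis
      unfolding G_def using LIMSEQ_unique[OF pointwise[of x]] pointwise[of "\<sigma> (cayley_sum x)"] by simp
  qed
  ultimately show "l \<in> vanishing_pullbacks"
    unfolding vanishing_pullbacks_def by (intro CollectI exI[of _ G]) simp
qed


section \<open>Algebraically independent exponentials of powers\<close>

text \<open>The term with the largest exponent among those with nonzero coefficient dominates.\<close>

lemma power_sum_diverges:
  fixes a d :: "'i \<Rightarrow> real"
  assumes "finite I" "inj_on a I" "\<And>i. i \<in> I \<Longrightarrow> 0 < a i" and ex: "\<exists>i\<in>I. d i \<noteq> 0"
  shows "(LIM t at_top. \<Sum>i\<in>I. d i * t powr a i :> at_top) \<or>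
    (LIM t at_top. \<Sum>i\<in>I. d i * t powr a i :> at_bot)"
proof -
  define J where "J = {i \<in> I. d i \<noteq> 0}"
  have "finite J" "J \<noteq> {}"
    using assms by (auto simp: J_def)
  then have "Max (a ` J) \<in> a ` J"
    by simp
  then obtain j where j: "j \<in> J" "a j = Max (a ` J)"
    by (metis imageE)
  have less: "a i < a j" if "i \<in> J" "i \<noteq> j" for i
  proof -
    have "a i \<le> a j"
      using \<open>finite J\<close> that j by simp
    moreover have "a i \<noteq> a j"
      using inj_onD[OF assms(2), of i j] that j(1) by (auto simp: J_def)
    ultimately show ?thesis by simp
  qed
  define q where "q t = (\<Sum>i\<in>J. d i * t powr (a i - a j))" for t
  have "((\<lambda>t. d i * t powr (a i - a j)) \<longlongrightarrow> (if i = j then d j else 0)) at_top" if "i \<in> J" for i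
  proof (cases "i = j")
    case True
    have "\<forall>\<^sub>F t in at_top. d i * t powr (a i - a j) = d j"
      using eventually_gt_at_top[of 0] by eventually_elim (simp add: True)
    then show ?thesis
      using True by (simp add: tendsto_eventually)
  next
    case False
    then show ?thesis
      using less[OF that] by (auto intro!: tendsto_mult_right_zero tendsto_neg_powr filterlim_ident)
  qed
  then have "(q \<longlongrightarrow> (\<Sum>i\<in>J. if i = j then d j else 0)) at_top"
    unfolding q_def by (rule tendsto_sum)
  then have q: "(q \<longlongrightarrow> d j) at_top"
    using \<open>finite J\<close> j by simp
  have top: "LIM t at_top. t powr a j :> at_top"
    using assms(3)[of j] j(1) by (intro real_powr_at_top) (simp only: J_def mem_Collect_eq)
  have "\<forall>\<^sub>F t in at_top. q t * t powr a j = (\<Sum>i\<in>I. d i * t powr a i)"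
    using eventually_gt_at_top[of 0]
  proof eventually_elim
    case (elim t)
    have "q t * t powr a j = (\<Sum>i\<in>J. d i * t powr a i)"
      unfolding q_def sum_distrib_right
      using elim by (intro sum.cong) (simp_all add: mult.assoc flip: powr_add)
    also have "\<dots> = (\<Sum>i\<in>I. d i * t powr a i)"
      using assms(1) by (intro sum.mono_neutral_left) (auto simp: J_def)
    finally show ?case .
  qed
  then have eq: "filterlim (\<lambda>t. q t * t powr a j) F at_top
      \<longleftrightarrow> (LIM t at_top. \<Sum>i\<in>I. d i * t powr a i :> F)" for F
    by (rule filterlim_cong[OF refl refl])
  show ?thesis
  proof (cases "0 < d j")
    case True
    then show ?thesis
      using filterlim_tendsto_pos_mult_at_top[OF q _ top] eq by blast
  next
    case False
    then have "d j < 0"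
      using j by (simp add: J_def)
    then show ?thesis
      using filterlim_tendsto_neg_mult_at_bot[OF q _ top] eq by blast
  qed
qed

text \<open>The hypothesis on differences orders the indices by growth of the exponents. If some coefficient
  were nonzero, take among those the index whose exponent grows most slowly and divide by its
  exponential: all other terms die out at infinity, so the coefficient is zero after all.\<close>

lemma exponential_sum_coefficients_zero:
  fixes p :: "'i \<Rightarrow> real \<Rightarrow> real" and c :: "'i \<Rightarrow> complex"
  assumes "finite A"
    and sep: "\<And>x y. x \<in> A \<Longrightarrow> y \<in> A \<Longrightarrow> x \<noteq> y \<Longrightarrow>
      (LIM t at_top. p x t - p y t :> at_top) \<or> (LIM t at_top. p x t - p y t :> at_bot)"
    and zero: "\<forall>\<^sub>F t in at_top. (\<Sum>x\<in>A. c x * exp (- complex_of_real (p x t))) = 0"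
    and "x \<in> A"
  shows "c x = 0"
proof (rule ccontr)
  assume "c x \<noteq> 0"
  define B where "B = {x \<in> A. c x \<noteq> 0}"
  have B: "finite B" "B \<noteq> {}"
    using assms(1,4) \<open>c x \<noteq> 0\<close> by (auto simp: B_def)
  define R where "R x y \<longleftrightarrow> (LIM t at_top. p y t - p x t :> at_top)" for x y
  have R_trans: "R x z" if "R x y" "R y z" for x y z
    using filterlim_at_top_add_at_top[OF that[unfolded R_def]] by (simp add: R_def)
  have R_irrefl: "\<not> R x x" for x
    by (auto simp: R_def filterlim_at_top intro!: exI[of _ 1])
  have "asymp_on B R" "transp_on B R"
    using R_trans R_irrefl by (auto intro!: asymp_onI transp_onI)
  then obtain m where m: "m \<in> B" "\<And>y. y \<in> B \<Longrightarrow> y \<noteq> m \<Longrightarrow> \<not> R y m"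
    using Finite_Set.bex_min_element[OF B(1) _ _ B(2), of R] by blast
  have "((\<lambda>t. c y * exp (- complex_of_real (p y t - p m t))) \<longlongrightarrow> (if y = m then c m else 0)) at_top"
    if "y \<in> B" for y
  proof (cases "y = m")
    case False
    have "LIM t at_top. p y t - p m t :> at_top"
      using sep[of m y] m(2)[OF that False] m(1) that False
      by (auto simp: R_def B_def filterlim_uminus_at_top)
    then have "((\<lambda>t. exp (- (p y t - p m t))) \<longlongrightarrow> 0) at_top"
      by (intro filterlim_compose[OF exp_at_bot] filterlim_compose[OF filterlim_uminus_at_bot_at_top])
    then have "((\<lambda>t. norm (c y * exp (- complex_of_real (p y t - p m t)))) \<longlongrightarrow> 0) at_top"
      unfolding norm_mult by (intro tendsto_mult_right_zero) (simp add: norm_exp_eq_Re)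
    then show ?thesis
      using False tendsto_norm_zero_iff by auto
  qed simp
  then have "((\<lambda>t. \<Sum>y\<in>B. c y * exp (- complex_of_real (p y t - p m t)))
      \<longlongrightarrow> (\<Sum>y\<in>B. if y = m then c m else 0)) at_top"
    by (rule tendsto_sum)
  moreover have "\<forall>\<^sub>F t in at_top. (\<Sum>y\<in>B. c y * exp (- complex_of_real (p y t - p m t))) = 0"
    using zero
  proof eventually_elim
    case (elim t)
    have "(\<Sum>y\<in>B. c y * exp (- complex_of_real (p y t - p m t)))
        = (\<Sum>y\<in>B. c y * exp (- complex_of_real (p y t))) * exp (complex_of_real (p m t))"
      unfolding sum_distrib_right
      by (intro sum.cong) (simp_all add: mult.assoc flip: exp_add)
    also have "(\<Sum>y\<in>B. c y * exp (- complex_of_real (p y t))) = (\<Sum>y\<in>A. c y * exp (- complex_of_real (p y t)))"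
      using assms(1) by (intro sum.mono_neutral_left) (auto simp: B_def)
    finally show ?case using elim by simp
  qed
  ultimately have "((\<lambda>_. 0) \<longlongrightarrow> (\<Sum>y\<in>B. if y = m then c m else 0)) (at_top :: real filter)"
    by (rule Lim_transform_eventually)
  from tendsto_unique[OF _ this tendsto_const]
  have "(\<Sum>y\<in>B. if y = m then c m else 0) = 0"
    by simp
  then show False
    using m B by (simp add: B_def)
qed

text \<open>Raising to a power of at most one shrinks the argument, which therefore stays below a right angle.\<close>

lemma Re_powr_pos:
  assumes "0 < Re s" "0 < \<alpha>" "\<alpha> \<le> 1"
  shows "0 < Re (s powr complex_of_real \<alpha>)"
proof -
  have "\<bar>\<alpha> * Im (Ln s)\<bar> \<le> \<bar>Im (Ln s)\<bar>"
    using assms by (simp add: abs_mult mult_left_le_one_le)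
  also have "\<dots> < pi / 2"
    using assms(1) by (rule Re_Ln_pos_lt_imp)
  finally have "0 < cos (\<alpha> * Im (Ln s))"
    by (intro cos_gt_zero_pi) auto
  then show ?thesis
    using assms(1) by (auto simp: powr_def Re_exp)
qed

text \<open>The generators, indexed by an interval and hence by a set of the cardinality of the continuum. A
  monomial in them is the exponential of a negative combination of powers with natural
  coefficients, and different monomials decay at different speeds.\<close>

definition power_exponential :: "real \<Rightarrow> hinf"
  where "power_exponential \<alpha> = pullback (\<lambda>s. exp (- (s powr complex_of_real \<alpha>)))"

lemma halfplane_nonpos_Reals: "s \<in> halfplane \<Longrightarrow> s \<notin> \<real>\<^sub>\<le>\<^sub>0"
  by (auto simp: complex_nonpos_Reals_iff)

lemma hinf_fun_power_exponential:
  assumes "0 < \<alpha>" "\<alpha> < 1" "x \<in> ball 0 1"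
  shows "hinf_fun (power_exponential \<alpha>) x = exp (- (cayley_sum x powr complex_of_real \<alpha>))"
proof -
  let ?g = "\<lambda>s. exp (- (s powr complex_of_real \<alpha>))"
  have "?g holomorphic_on halfplane"
    by (intro holomorphic_intros) (use halfplane_nonpos_Reals in auto)
  moreover have "bounded (?g ` halfplane)"
    by (rule boundedI[of _ 1]) (use assms in \<open>auto intro!: less_imp_le[OF Re_powr_pos]\<close>)
  ultimately show ?thesis
    using assms(3) by (simp add: power_exponential_def hinf_fun_pullback)
qed

lemma hinf_fun_sum: "hinf_fun (sum f A) x = (\<Sum>a\<in>A. hinf_fun (f a) x)"
  by (induction A rule: infinite_finite_induct) (auto simp: zero_hinf.rep_eq plus_hinf.rep_eq)

lemma hinf_fun_prod: "x \<in> ball 0 1 \<Longrightarrow> hinf_fun (prod f A) x = (\<Prod>a\<in>A. hinf_fun (f a) x)"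
  by (induction A rule: infinite_finite_induct) (auto simp: one_hinf.rep_eq times_hinf.rep_eq)

lemma hinf_fun_power: "x \<in> ball 0 1 \<Longrightarrow> hinf_fun (f ^ n) x = hinf_fun f x ^ n"
  by (induction n) (auto simp: one_hinf.rep_eq times_hinf.rep_eq)

text \<open>The exponent that belongs to a monomial in the generators with powers \<open>a i\<close>.\<close>

definition power_sum :: "(nat \<Rightarrow> real) \<Rightarrow> (nat \<Rightarrow>\<^sub>0 nat) \<Rightarrow> complex \<Rightarrow> complex"
  where "power_sum a m s = (\<Sum>i\<in>Poly_Mapping.keys m.
    of_nat (Poly_Mapping.lookup m i) * s powr complex_of_real (a i))"

lemma power_sum_of_real:
  assumes "0 \<le> t" "finite I" "Poly_Mapping.keys m \<subseteq> I"
  shows "power_sum a m (complex_of_real t)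
    = complex_of_real (\<Sum>i\<in>I. real (Poly_Mapping.lookup m i) * t powr a i)"
  unfolding power_sum_def of_real_sum
  using assms by (intro sum.mono_neutral_cong_left) (auto simp: powr_of_real in_keys_iff)

lemma power_exponential_vanishing:
  assumes "\<alpha> \<in> {0<..<1}"
  shows "power_exponential \<alpha> \<in> vanishing_pullbacks"
  unfolding vanishing_pullbacks_def
proof (intro CollectI exI[of _ "\<lambda>s. exp (- (s powr complex_of_real \<alpha>))"] conjI ballI)
  show "(\<lambda>s. exp (- (s powr complex_of_real \<alpha>))) holomorphic_on halfplane"
    by (intro holomorphic_intros) (use halfplane_nonpos_Reals in auto)
  have "((\<lambda>t. exp (- (t powr \<alpha>))) \<longlongrightarrow> 0) at_top"
    using assms
    by (intro filterlim_compose[OF exp_at_bot] filterlim_compose[OF filterlim_uminus_at_bot_at_top]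
        real_powr_at_top) auto
  then show "((\<lambda>t. exp (- (complex_of_real t powr complex_of_real \<alpha>))) \<longlongrightarrow> 0) at_top"
  proof (rule Lim_null_comparison[rotated])
    show "\<forall>\<^sub>F t in at_top. norm (exp (- (complex_of_real t powr complex_of_real \<alpha>))) \<le> exp (- (t powr \<alpha>))"
      using eventually_ge_at_top[of 0] by eventually_elim (simp add: powr_of_real)
  qed
qed (use assms in \<open>auto simp: hinf_fun_power_exponential\<close>)

lemma power_exponential_exponents:
  assumes "y ` {..<n} \<subseteq> power_exponential ` {0<..<1}"
  obtains a where "\<And>i. i < n \<Longrightarrow> a i \<in> {0<..<1}" "\<And>i. i < n \<Longrightarrow> y i = power_exponential (a i)"
proof -
  have "y i \<in> power_exponential ` {0<..<1}" if "i < n" for i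
    using assms that by (auto simp only: image_subset_iff lessThan_iff)
  then have "\<forall>i. \<exists>\<alpha>. i < n \<longrightarrow> \<alpha> \<in> {0<..<1} \<and> y i = power_exponential \<alpha>"
    by blast
  from choice[OF this] show ?thesis
    using that by blast
qed

lemma hinf_fun_cpoly_eval:
  assumes "x \<in> ball 0 1" "Q \<in> cpolys n"
    and y: "\<And>i. i < n \<Longrightarrow> y i = power_exponential (a i)" "\<And>i. i < n \<Longrightarrow> a i \<in> {0<..<1}"
  shows "hinf_fun (cpoly_eval Q y) x
    = (\<Sum>m\<in>Poly_Mapping.keys Q. Poly_Mapping.lookup Q m * exp (- power_sum a m (cayley_sum x)))"
  unfolding cpoly_eval_def hinf_fun_sum
proof (rule sum.cong)
  fix m assume "m \<in> Poly_Mapping.keys Q"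
  then have keys: "Poly_Mapping.keys m \<subseteq> {..<n}"
    using assms(2) by (auto simp: cpolys_def)
  have "(\<Prod>i\<in>Poly_Mapping.keys m. hinf_fun (y i) x ^ Poly_Mapping.lookup m i)
      = (\<Prod>i\<in>Poly_Mapping.keys m.
          exp (of_nat (Poly_Mapping.lookup m i) * - (cayley_sum x powr complex_of_real (a i))))"
  proof (rule prod.cong[OF refl])
    fix i assume "i \<in> Poly_Mapping.keys m"
    then have "i < n"
      using keys by auto
    then show "hinf_fun (y i) x ^ Poly_Mapping.lookup m i
        = exp (of_nat (Poly_Mapping.lookup m i) * - (cayley_sum x powr complex_of_real (a i)))"
      using y[of i] assms(1) unfolding exp_of_nat_mult by (simp add: hinf_fun_power_exponential)
  qed
  also have "\<dots> = exp (- power_sum a m (cayley_sum x))"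
    by (simp add: power_sum_def sum_negf flip: exp_sum)
  finally show "hinf_fun (Poly_Mapping.lookup Q m *\<^sub>C (\<Prod>i\<in>Poly_Mapping.keys m. y i ^ Poly_Mapping.lookup m i)) x
      = Poly_Mapping.lookup Q m * exp (- power_sum a m (cayley_sum x))"
    using assms(1) by (simp add: scaleC_hinf.rep_eq hinf_fun_prod hinf_fun_power)
qed simp

text \<open>Each monomial of a polynomial without constant term contains a generator, which forces it to decay
  along the positive real axis.\<close>

lemma generated_subalgebra_power_exponentials:
  "generated_subalgebra (power_exponential ` {0<..<1}) \<subseteq> vanishing_pullbacks"
proof
  fix f assume "f \<in> generated_subalgebra (power_exponential ` {0<..<1})"
  then obtain n Q y where Q: "Q \<in> cpolys n" "Poly_Mapping.lookup Q 0 = 0"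
    and y: "y ` {..<n} \<subseteq> power_exponential ` {0<..<1}" and f: "f = cpoly_eval Q y"
    by (auto simp: generated_subalgebra_def)
  obtain a where a: "\<And>i. i < n \<Longrightarrow> a i \<in> {0<..<1}"
    and ya: "\<And>i. i < n \<Longrightarrow> y i = power_exponential (a i)"
    using power_exponential_exponents[OF y] by blast
  define g where "g s = (\<Sum>m\<in>Poly_Mapping.keys Q. Poly_Mapping.lookup Q m * exp (- power_sum a m s))" for s
  have "g holomorphic_on halfplane"
    unfolding g_def power_sum_def
    by (intro holomorphic_intros) (use halfplane_nonpos_Reals in auto)
  moreover have "((\<lambda>t. g (complex_of_real t)) \<longlongrightarrow> (\<Sum>m\<in>Poly_Mapping.keys Q. 0)) at_top"
    unfolding g_def
  proof (intro tendsto_sum tendsto_mult_right_zero)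
    fix m assume m: "m \<in> Poly_Mapping.keys Q"
    then have "m \<noteq> 0"
      using Q(2) by (auto simp: in_keys_iff)
    then obtain j where j: "j \<in> Poly_Mapping.keys m"
      by (metis ex_in_conv keys_eq_empty)
    then have "j < n"
      using m Q(1) by (auto simp: cpolys_def)
    show "((\<lambda>t. exp (- power_sum a m (complex_of_real t))) \<longlongrightarrow> 0) at_top"
    proof (rule Lim_null_comparison)
      show "((\<lambda>t. exp (- (t powr a j))) \<longlongrightarrow> 0) at_top"
        using a[OF \<open>j < n\<close>]
        by (intro filterlim_compose[OF exp_at_bot] filterlim_compose[OF filterlim_uminus_at_bot_at_top]
            real_powr_at_top) auto
      show "\<forall>\<^sub>F t in at_top. norm (exp (- power_sum a m (complex_of_real t))) \<le> exp (- (t powr a j))"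
        using eventually_gt_at_top[of 0]
      proof eventually_elim
        case (elim t)
        have "1 * t powr a j \<le> real (Poly_Mapping.lookup m j) * t powr a j"
          using j by (intro mult_right_mono) (auto simp: in_keys_iff Suc_le_eq)
        also have "\<dots> \<le> (\<Sum>i\<in>Poly_Mapping.keys m. real (Poly_Mapping.lookup m i) * t powr a i)"
          using j by (intro member_le_sum) auto
        finally show ?case
          using elim by (simp add: power_sum_of_real[OF _ finite_keys subset_refl] norm_exp_eq_Re)
      qed
    qed
  qed
  moreover have "\<forall>x\<in>ball 0 1. hinf_fun f x = g (cayley_sum x)"
    unfolding f g_def using hinf_fun_cpoly_eval[where y = y and a = a, OF _ Q(1) ya a] by blast
  ultimately show "f \<in> vanishing_pullbacks"
    unfolding vanishing_pullbacks_def by auto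
qed

text \<open>Identities between functions on the ball become identities on the positive real axis, because that
  axis is covered by the image of the ball.\<close>

lemma eventually_at_real_points:
  assumes "\<And>x. x \<in> ball 0 1 \<Longrightarrow> P (cayley_sum x)"
  shows "\<forall>\<^sub>F t in at_top. P (complex_of_real t)"
  using eventually_gt_at_top[of 0]
proof eventually_elim
  case (elim t)
  then obtain x where "x \<in> ball 0 1" "cayley_sum x = complex_of_real t"
    using cayley_sum_surj[of "complex_of_real t"] by auto
  then show ?case
    using assms by metis
qed

lemma inj_power_exponential: "inj_on power_exponential {0<..<1}"
proof (rule inj_onI)
  fix \<alpha> \<beta> :: real
  assume \<alpha>\<beta>: "\<alpha> \<in> {0<..<1}" "\<beta> \<in> {0<..<1}" and eq: "power_exponential \<alpha> = power_exponential \<beta>"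
  obtain x where x: "x \<in> ball 0 1" "cayley_sum x = 2"
    using cayley_sum_surj[of 2] by auto
  have real: "2 powr complex_of_real \<gamma> = complex_of_real (2 powr \<gamma>)" for \<gamma>
    using powr_of_real[of 2 \<gamma>] by simp
  have "exp (- complex_of_real (2 powr \<alpha>)) = exp (- complex_of_real (2 powr \<beta>))"
    using hinf_fun_power_exponential[OF _ _ x(1), of \<alpha>] hinf_fun_power_exponential[OF _ _ x(1), of \<beta>] \<alpha>\<beta> eq
    by (simp add: x(2) flip: real)
  then have "exp (- (2 powr \<alpha>)) = exp (- (2 powr \<beta> :: real))"
    by (simp only: exp_of_real of_real_eq_iff flip: of_real_minus)
  then show "\<alpha> = \<beta>"
    using powr_inj[of 2 \<alpha> \<beta>] by simp
qed

text \<open>Two different monomials have exponents whose difference is a nontrivial sum of distinct powers, and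
  such a sum diverges. The coefficients of a vanishing polynomial are then all zero by comparison of
  decay.\<close>

lemma algebraically_independent_power_exponentials:
  "algebraically_independent (power_exponential ` {0<..<1})"
  unfolding algebraically_independent_def
proof (intro allI ballI impI)
  fix n Q and y :: "nat \<Rightarrow> hinf"
  assume Q: "Q \<in> cpolys n" and inj: "inj_on y {..<n}"
    and y: "y ` {..<n} \<subseteq> power_exponential ` {0<..<1}" and zero: "cpoly_eval Q y = 0"
  obtain a where a: "\<And>i. i < n \<Longrightarrow> a i \<in> {0<..<1}"
    and ya: "\<And>i. i < n \<Longrightarrow> y i = power_exponential (a i)"
    using power_exponential_exponents[OF y] by blast
  have inj_a: "inj_on a {..<n}"
    using inj ya by (auto simp: inj_on_def)
  define p where "p m t = (\<Sum>i<n. real (Poly_Mapping.lookup m i) * t powr a i)" for m :: "nat \<Rightarrow>\<^sub>0 nat" and t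
  have keys: "Poly_Mapping.keys m \<subseteq> {..<n}" if "m \<in> Poly_Mapping.keys Q" for m
    using that Q by (auto simp: cpolys_def)
  have "\<forall>\<^sub>F t in at_top. (\<Sum>m\<in>Poly_Mapping.keys Q.
      Poly_Mapping.lookup Q m * exp (- power_sum a m (complex_of_real t))) = 0"
  proof (rule eventually_at_real_points)
    fix x :: c0 assume "x \<in> ball 0 1"
    from hinf_fun_cpoly_eval[where y = y and a = a, OF this Q ya a]
    show "(\<Sum>m\<in>Poly_Mapping.keys Q. Poly_Mapping.lookup Q m * exp (- power_sum a m (cayley_sum x))) = 0"
      by (simp add: zero zero_hinf.rep_eq)
  qed
  then have ev: "\<forall>\<^sub>F t in at_top. (\<Sum>m\<in>Poly_Mapping.keys Q.
      Poly_Mapping.lookup Q m * exp (- complex_of_real (p m t))) = 0"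
    using eventually_gt_at_top[of 0]
  proof eventually_elim
    case (elim t)
    have "power_sum a m (complex_of_real t) = complex_of_real (p m t)" if "m \<in> Poly_Mapping.keys Q" for m
      unfolding p_def using elim keys[OF that] by (intro power_sum_of_real) auto
    then have "(\<Sum>m\<in>Poly_Mapping.keys Q. Poly_Mapping.lookup Q m * exp (- complex_of_real (p m t)))
        = (\<Sum>m\<in>Poly_Mapping.keys Q. Poly_Mapping.lookup Q m * exp (- power_sum a m (complex_of_real t)))"
      by (intro sum.cong) simp_all
    then show ?case
      using elim by simp
  qed
  have "Poly_Mapping.lookup Q m = 0" if "m \<in> Poly_Mapping.keys Q" for m
  proof (rule exponential_sum_coefficients_zero[where p = p and c = "Poly_Mapping.lookup Q",
        OF finite_keys _ ev that])
    fix m m' assume mm': "m \<in> Poly_Mapping.keys Q" "m' \<in> Poly_Mapping.keys Q" "m \<noteq> m'"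
    have "\<not> (\<forall>i. Poly_Mapping.lookup m i = Poly_Mapping.lookup m' i)"
      using poly_mapping_eqI[of m m'] mm'(3) by auto
    then obtain i where i: "Poly_Mapping.lookup m i \<noteq> Poly_Mapping.lookup m' i"
      by auto
    have "i < n"
    proof (rule ccontr)
      assume "\<not> i < n"
      then have "i \<notin> Poly_Mapping.keys m" "i \<notin> Poly_Mapping.keys m'"
        using keys[OF mm'(1)] keys[OF mm'(2)] by auto
      then show False
        using i by (simp add: in_keys_iff)
    qed
    then have "\<exists>i\<in>{..<n}. real (Poly_Mapping.lookup m i) - real (Poly_Mapping.lookup m' i) \<noteq> 0"
      using i by auto
    from power_sum_diverges[OF finite_lessThan inj_a _ this]
    show "(LIM t at_top. p m t - p m' t :> at_top) \<or> (LIM t at_top. p m t - p m' t :> at_bot)"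
      using a by (simp add: p_def sum_subtractf left_diff_distrib)
  qed
  then show "Q = 0"
    by (intro poly_mapping_eqI) (auto simp: in_keys_iff)
qed

lemma independent_power_exponentials:
  "complex_vector.independent (power_exponential ` {0<..<1})"
  unfolding complex_vector.independent_explicit_finite_subsets
proof (intro allI impI ballI)
  fix S u f
  assume "S \<subseteq> power_exponential ` {0<..<1}" "finite S"
    and zero: "(\<Sum>f\<in>S. u f *\<^sub>C f) = 0" and f: "f \<in> S"
  then obtain A where A: "finite A" "A \<subseteq> {0<..<1}" "S = power_exponential ` A"
    using finite_subset_image[of S power_exponential "{0<..<1}"] by blast
  have inj: "inj_on power_exponential A"
    using inj_power_exponential A(2) by (rule inj_on_subset)
  have "(\<Sum>\<alpha>\<in>A. u (power_exponential \<alpha>) * exp (- (cayley_sum x powr complex_of_real \<alpha>))) = 0"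
    if x: "x \<in> ball 0 1" for x
  proof -
    have "(\<Sum>\<alpha>\<in>A. u (power_exponential \<alpha>) * exp (- (cayley_sum x powr complex_of_real \<alpha>)))
        = (\<Sum>\<alpha>\<in>A. hinf_fun (u (power_exponential \<alpha>) *\<^sub>C power_exponential \<alpha>) x)"
      using A(2) x by (intro sum.cong) (auto simp: scaleC_hinf.rep_eq hinf_fun_power_exponential)
    also have "\<dots> = hinf_fun (\<Sum>f\<in>S. u f *\<^sub>C f) x"
      by (simp add: A(3) sum.reindex[OF inj] hinf_fun_sum)
    finally show ?thesis
      by (simp add: zero zero_hinf.rep_eq)
  qed
  then have "\<forall>\<^sub>F t in at_top.
      (\<Sum>\<alpha>\<in>A. u (power_exponential \<alpha>) * exp (- (complex_of_real t powr complex_of_real \<alpha>))) = 0"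
    by (rule eventually_at_real_points)
  then have ev: "\<forall>\<^sub>F t in at_top.
      (\<Sum>\<alpha>\<in>A. u (power_exponential \<alpha>) * exp (- complex_of_real (t powr \<alpha>))) = 0"
    using eventually_gt_at_top[of 0] by eventually_elim (simp add: powr_of_real)
  have "u (power_exponential \<alpha>) = 0" if "\<alpha> \<in> A" for \<alpha>
  proof (rule exponential_sum_coefficients_zero[where p = "\<lambda>\<alpha> t. t powr \<alpha>" and
        c = "\<lambda>\<alpha>. u (power_exponential \<alpha>)", OF A(1) _ ev that])
    fix \<alpha> \<beta> assume \<alpha>\<beta>: "\<alpha> \<in> A" "\<beta> \<in> A" "\<alpha> \<noteq> \<beta>"
    have "0 < i" if "i \<in> {\<alpha>, \<beta>}" for i
      using that \<alpha>\<beta> A(2) by auto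
    from power_sum_diverges[of "{\<alpha>, \<beta>}" "\<lambda>i. i" "\<lambda>i. if i = \<alpha> then 1 else -1", OF _ _ this]
    show "(LIM t at_top. t powr \<alpha> - t powr \<beta> :> at_top) \<or> (LIM t at_top. t powr \<alpha> - t powr \<beta> :> at_bot)"
      using \<alpha>\<beta>(3) by simp
  qed
  then show "u f = 0"
    using f A(3) by blast
qed


section \<open>Lacunary exponential series\<close>

lemma norm_cis_diff_le: "norm (cis a - cis b) \<le> \<bar>a - b\<bar>"
proof -
  have "norm (cis a - cis b) = norm (cis b * (cis (a - b) - 1))"
    by (simp add: right_diff_distrib cis_mult)
  also have "\<dots> = 2 * \<bar>sin ((a - b) / 2)\<bar>"
    using dist_exp_i_1[of "a - b"] by (simp add: norm_mult cis_conv_exp dist_norm)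
  also have "\<dots> \<le> \<bar>a - b\<bar>"
    using abs_sin_x_le_abs_x[of "(a - b) / 2"] by simp
  finally show ?thesis .
qed

text \<open>Angles at the frequencies \<open>N ^ j\<close> can be prescribed almost independently. By induction a number \<open>t'\<close>
  realises the angles from the second one on. Every \<open>t = (t' + 2 * pi * k) / N\<close> with integral \<open>k\<close>
  realises them, one frequency higher, with the same error; these numbers have distance \<open>2 * pi / N\<close>,
  so one of them is this close to the first angle.\<close>

lemma lacunary_phases:
  assumes "0 < N"
  shows "\<exists>t. \<forall>j<n. norm (cis (real (N ^ j) * t) - cis (\<theta> j)) \<le> 2 * pi / real N"
proof (induction n arbitrary: \<theta>)
  case (Suc n)
  obtain t' where t': "\<And>j. j < n \<Longrightarrow> norm (cis (real (N ^ j) * t') - cis (\<theta> (Suc j))) \<le> 2 * pi / real N"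
    using Suc.IH[of "\<lambda>j. \<theta> (Suc j)"] by blast
  define k where "k = \<lfloor>(real N * \<theta> 0 - t') / (2 * pi)\<rfloor>"
  define t where "t = (t' + 2 * pi * of_int k) / real N"
  have "\<bar>t - \<theta> 0\<bar> \<le> 2 * pi / real N"
  proof -
    have "of_int k \<le> (real N * \<theta> 0 - t') / (2 * pi)" "(real N * \<theta> 0 - t') / (2 * pi) < of_int k + 1"
      unfolding k_def by linarith+
    then have "2 * pi * of_int k \<le> real N * \<theta> 0 - t'" "real N * \<theta> 0 - t' < 2 * pi * of_int k + 2 * pi"
      by (simp_all add: pos_le_divide_eq pos_divide_less_eq algebra_simps)
    then have "\<bar>t' + 2 * pi * of_int k - real N * \<theta> 0\<bar> \<le> 2 * pi"
      by linarith
    moreover have "t - \<theta> 0 = (t' + 2 * pi * of_int k - real N * \<theta> 0) / real N"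
      using assms by (simp add: t_def diff_divide_distrib)
    ultimately show ?thesis
      using assms by (simp add: divide_right_mono)
  qed
  then have "norm (cis (real (N ^ 0) * t) - cis (\<theta> 0)) \<le> 2 * pi / real N"
    using norm_cis_diff_le[of t "\<theta> 0"] by simp
  moreover have "cis (real (N ^ Suc j) * t) = cis (real (N ^ j) * t')" for j
  proof -
    have "real (N ^ Suc j) * t = real (N ^ j) * t' + 2 * pi * of_int (int (N ^ j) * k)"
      using assms by (simp add: t_def field_simps)
    then show ?thesis
      using cis_multiple_2pi[of "of_int (int (N ^ j) * k)"] by (simp only: cis_mult[symmetric]) simp
  qed
  ultimately have "\<forall>j<Suc n. norm (cis (real (N ^ j) * t) - cis (\<theta> j)) \<le> 2 * pi / real N"
    using t' less_Suc_eq_0_disj by auto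
  then show ?case ..
qed simp

text \<open>In terms of \<open>w = exp (- s)\<close> this is the power series with coefficients \<open>\<beta> j\<close> at the Hadamard
  lacunary exponents \<open>N ^ j\<close>.\<close>

definition lacunary_series :: "nat \<Rightarrow> (nat \<Rightarrow> complex) \<Rightarrow> complex \<Rightarrow> complex"
  where "lacunary_series N \<beta> s = suminf (\<lambda>j. \<beta> j * exp (- (of_nat (N ^ j) * s)))"

text \<open>All frequencies are at least one, so the decay along the real axis is uniform in \<open>j\<close>.\<close>

lemma lacunary_term_le:
  assumes "0 < N" "0 \<le> Re s"
  shows "norm (\<beta> j * exp (- (of_nat (N ^ j) * s))) \<le> norm (\<beta> j) * exp (- Re s)"
proof -
  have "1 \<le> real (N ^ j)"
    using assms(1) by (simp add: Suc_le_eq del: of_nat_power)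
  then have "1 * Re s \<le> real (N ^ j) * Re s"
    using assms(2) by (rule mult_right_mono)
  moreover have "Re (of_nat (N ^ j) * s) = real (N ^ j) * Re s"
    by (simp del: of_nat_power)
  ultimately show ?thesis
    unfolding norm_mult norm_exp_eq_Re by (intro mult_left_mono) simp_all
qed

lemma lacunary_term_le_coefficient:
  assumes "0 < N" "0 \<le> Re s"
  shows "norm (\<beta> j * exp (- (of_nat (N ^ j) * s))) \<le> norm (\<beta> j)"
  using lacunary_term_le[OF assms, of \<beta> j] mult_left_mono[of "exp (- Re s)" 1 "norm (\<beta> j)"] assms(2)
  by simp

lemma lacunary_series_sums:
  assumes "0 < N" "\<beta> \<in> ell1" "0 \<le> Re s"
  shows "(\<lambda>j. \<beta> j * exp (- (of_nat (N ^ j) * s))) sums lacunary_series N \<beta> s"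
  unfolding lacunary_series_def
proof (rule summable_sums, rule summable_comparison_test')
  show "summable (\<lambda>j. norm (\<beta> j))"
    using assms(2) by (simp add: ell1_def)
qed (rule lacunary_term_le_coefficient[OF assms(1,3)])

lemma norm_lacunary_series_le:
  assumes "0 < N" "\<beta> \<in> ell1" "0 \<le> Re s"
  shows "norm (lacunary_series N \<beta> s) \<le> ell1_norm \<beta> * exp (- Re s)"
proof -
  have \<beta>: "summable (\<lambda>j. norm (\<beta> j))"
    using assms(2) by (simp add: ell1_def)
  then have "norm (lacunary_series N \<beta> s) \<le> suminf (\<lambda>j. norm (\<beta> j) * exp (- Re s))"
    unfolding lacunary_series_def
    by (intro norm_suminf_le lacunary_term_le summable_mult2 assms(1,3))
  also have "\<dots> = ell1_norm \<beta> * exp (- Re s)"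
    using \<beta> by (simp add: ell1_norm_def suminf_mult2)
  finally show ?thesis .
qed

lemma ell1_norm_nonneg: "\<beta> \<in> ell1 \<Longrightarrow> 0 \<le> ell1_norm \<beta>"
  by (simp add: ell1_def ell1_norm_def suminf_nonneg)

lemma norm_lacunary_series_le_ell1:
  assumes "0 < N" "\<beta> \<in> ell1" "0 \<le> Re s"
  shows "norm (lacunary_series N \<beta> s) \<le> ell1_norm \<beta>"
  using norm_lacunary_series_le[OF assms] ell1_norm_nonneg[OF assms(2)]
    mult_left_mono[of "exp (- Re s)" 1 "ell1_norm \<beta>"] assms(3) by simp

lemma holomorphic_lacunary_series:
  assumes "0 < N" "\<beta> \<in> ell1"
  shows "lacunary_series N \<beta> holomorphic_on halfplane"
proof (rule holomorphic_uniform_sequence[OF open_halfplane])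
  show "(\<lambda>s. \<Sum>j<n. \<beta> j * exp (- (of_nat (N ^ j) * s))) holomorphic_on halfplane" for n
    by (intro holomorphic_intros)
  have unif: "uniform_limit halfplane (\<lambda>n s. \<Sum>j<n. \<beta> j * exp (- (of_nat (N ^ j) * s)))
      (lacunary_series N \<beta>) sequentially"
    unfolding lacunary_series_def[abs_def]
  proof (rule Weierstrass_m_test)
    show "summable (\<lambda>j. norm (\<beta> j))"
      using assms(2) by (simp add: ell1_def)
  qed (rule lacunary_term_le_coefficient[OF assms(1)], simp)
  fix s assume "s \<in> halfplane"
  then obtain d where "0 < d" "cball s d \<subseteq> halfplane"
    using open_halfplane open_contains_cball by blast
  then show "\<exists>d>0. cball s d \<subseteq> halfplane \<and> uniform_limit (cball s d)
      (\<lambda>n s. \<Sum>j<n. \<beta> j * exp (- (of_nat (N ^ j) * s))) (lacunary_series N \<beta>) sequentially"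
    using uniform_limit_on_subset[OF unif] by auto
qed

lemma hinf_fun_pullback_lacunary:
  assumes "0 < N" "\<beta> \<in> ell1"
  shows "hinf_fun (pullback (lacunary_series N \<beta>))
    = (\<lambda>x. if x \<in> ball 0 1 then lacunary_series N \<beta> (cayley_sum x) else 0)"
proof (rule hinf_fun_pullback)
  show "bounded (lacunary_series N \<beta> ` halfplane)"
    by (rule boundedI[of _ "ell1_norm \<beta>"]) (auto intro!: norm_lacunary_series_le_ell1 assms)
qed (rule holomorphic_lacunary_series[OF assms])

lemma pullback_lacunary_vanishing:
  assumes "0 < N" "\<beta> \<in> ell1"
  shows "pullback (lacunary_series N \<beta>) \<in> vanishing_pullbacks"
  unfolding vanishing_pullbacks_def
proof (intro CollectI exI[of _ "lacunary_series N \<beta>"] conjI)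
  show "((\<lambda>t. lacunary_series N \<beta> (complex_of_real t)) \<longlongrightarrow> 0) at_top"
  proof (rule Lim_null_comparison)
    show "((\<lambda>t. ell1_norm \<beta> * exp (- t)) \<longlongrightarrow> 0) at_top"
      by (intro tendsto_mult_right_zero filterlim_compose[OF exp_at_bot] filterlim_uminus_at_bot_at_top)
    show "\<forall>\<^sub>F t in at_top. norm (lacunary_series N \<beta> (complex_of_real t)) \<le> ell1_norm \<beta> * exp (- t)"
      using eventually_ge_at_top[of 0]
    proof eventually_elim
      case (elim t)
      then show ?case
        using norm_lacunary_series_le[OF assms, of "complex_of_real t"] by simp
    qed
  qed
qed (simp_all add: holomorphic_lacunary_series hinf_fun_pullback_lacunary assms)

text \<open>On the imaginary axis choose a point at which the first \<open>n\<close> terms of the series have almost the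
  phase zero. There the partial sum has real part almost the sum of the moduli of its coefficients.
  The partial sum is continuous up to the imaginary axis, hence bounded there by the supremum over
  the half-plane plus the tail of the coefficients, which tends to zero with \<open>n\<close>.\<close>

lemma norm_pullback_lacunary_ge:
  assumes "0 < N" "\<beta> \<in> ell1"
  shows "(1 - 2 * pi / real N) * ell1_norm \<beta> \<le> norm (pullback (lacunary_series N \<beta>))"
proof -
  define B where "B = norm (pullback (lacunary_series N \<beta>))"
  define \<delta> where "\<delta> = 2 * pi / real N"
  define P where "P n s = (\<Sum>j<n. \<beta> j * exp (- (of_nat (N ^ j) * s)))" for n s
  define A where "A n = (\<Sum>j<n. norm (\<beta> j))" for n
  have \<beta>: "summable (\<lambda>j. norm (\<beta> j))"
    using assms(2) by (simp add: ell1_def)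
  have le_B: "norm (lacunary_series N \<beta> s) \<le> B" if s: "s \<in> halfplane" for s
  proof -
    obtain x where "x \<in> ball 0 1" "cayley_sum x = s"
      using cayley_sum_surj[of s] s by auto
    then show ?thesis
      using norm_hinf_upper[of "pullback (lacunary_series N \<beta>)" x]
      by (simp add: B_def hinf_fun_pullback_lacunary assms)
  qed
  have inner: "norm (P n s) \<le> B + (ell1_norm \<beta> - A n)" if s: "s \<in> halfplane" for n s
  proof -
    have Re: "0 \<le> Re s" using s by simp
    note sums = lacunary_series_sums[OF assms Re]
    have "norm (suminf (\<lambda>j. \<beta> (j + n) * exp (- (of_nat (N ^ (j + n)) * s)))) \<le> suminf (\<lambda>j. norm (\<beta> (j + n)))"
      using summable_ignore_initial_segment[OF \<beta>, of n]
      by (intro norm_suminf_le lacunary_term_le_coefficient[OF assms(1) Re])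
    moreover have "lacunary_series N \<beta> s = suminf (\<lambda>j. \<beta> (j + n) * exp (- (of_nat (N ^ (j + n)) * s))) + P n s"
      unfolding P_def lacunary_series_def by (rule suminf_split_initial_segment[OF sums_summable[OF sums]])
    moreover have "ell1_norm \<beta> = suminf (\<lambda>j. norm (\<beta> (j + n))) + A n"
      unfolding A_def ell1_norm_def by (rule suminf_split_initial_segment[OF \<beta>])
    ultimately show ?thesis
      using le_B[OF s] norm_triangle_ineq4[of "lacunary_series N \<beta> s"
          "suminf (\<lambda>j. \<beta> (j + n) * exp (- (of_nat (N ^ (j + n)) * s)))"] by simp
  qed
  have boundary: "norm (P n (- \<i> * of_real t)) \<le> B + (ell1_norm \<beta> - A n)" for n t
  proof (rule LIMSEQ_le_const2)
    have "(\<lambda>k. P n (of_real (inverse (real (Suc k))) - \<i> * of_real t)) \<longlonglongrightarrow> P n (of_real 0 - \<i> * of_real t)"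
      unfolding P_def by (intro tendsto_intros LIMSEQ_inverse_real_of_nat)
    then show "(\<lambda>k. norm (P n (of_real (inverse (real (Suc k))) - \<i> * of_real t))) \<longlonglongrightarrow> norm (P n (- \<i> * of_real t))"
      using tendsto_norm by fastforce
    show "\<exists>N. \<forall>k\<ge>N. norm (P n (of_real (inverse (real (Suc k))) - \<i> * of_real t)) \<le> B + (ell1_norm \<beta> - A n)"
      by (intro exI allI impI inner) simp
  qed
  have "(1 - \<delta>) * A n \<le> B + (ell1_norm \<beta> - A n)" for n
  proof -
    obtain t where t: "\<And>j. j < n \<Longrightarrow> norm (cis (real (N ^ j) * t) - cis (- Arg (\<beta> j))) \<le> \<delta>"
      using lacunary_phases[OF assms(1), of n "\<lambda>j. - Arg (\<beta> j)"] by (auto simp: \<delta>_def)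
    have term_ge: "(1 - \<delta>) * norm (\<beta> j) \<le> Re (\<beta> j * exp (- (of_nat (N ^ j) * (- \<i> * of_real t))))"
      if "j < n" for j
    proof -
      have "\<beta> j * cis (- Arg (\<beta> j)) = of_real (norm (\<beta> j))"
        by (subst rcis_cmod_Arg[symmetric]) (simp add: rcis_def cis_mult)
      then have "norm (\<beta> j * cis (real (N ^ j) * t) - of_real (norm (\<beta> j)))
          = norm (\<beta> j) * norm (cis (real (N ^ j) * t) - cis (- Arg (\<beta> j)))"
        by (metis norm_mult right_diff_distrib)
      also have "\<dots> \<le> norm (\<beta> j) * \<delta>"
        by (intro mult_left_mono t that) simp
      finally have "norm (of_real (norm (\<beta> j)) - \<beta> j * cis (real (N ^ j) * t)) \<le> norm (\<beta> j) * \<delta>"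
        by (simp only: norm_minus_commute)
      moreover have "Re (of_real (norm (\<beta> j)) - \<beta> j * cis (real (N ^ j) * t))
          \<le> norm (of_real (norm (\<beta> j)) - \<beta> j * cis (real (N ^ j) * t))"
        by (rule complex_Re_le_cmod)
      moreover have "Re (of_real (norm (\<beta> j)) - \<beta> j * cis (real (N ^ j) * t))
          = norm (\<beta> j) - Re (\<beta> j * cis (real (N ^ j) * t))"
        by (simp only: minus_complex.sel Re_complex_of_real)
      moreover have "exp (- (of_nat (N ^ j) * (- \<i> * of_real t))) = cis (real (N ^ j) * t)"
        by (simp add: cis_conv_exp mult_ac)
      moreover have "(1 - \<delta>) * norm (\<beta> j) = norm (\<beta> j) - norm (\<beta> j) * \<delta>"
        by (simp add: algebra_simps)
      ultimately show ?thesis by (simp only:)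
    qed
    have "(1 - \<delta>) * A n \<le> Re (P n (- \<i> * of_real t))"
      unfolding A_def P_def sum_distrib_left Re_sum by (intro sum_mono term_ge) simp
    also have "\<dots> \<le> norm (P n (- \<i> * of_real t))"
      by (rule complex_Re_le_cmod)
    also have "\<dots> \<le> B + (ell1_norm \<beta> - A n)"
      by (rule boundary)
    finally show ?thesis .
  qed
  moreover have A: "A \<longlonglongrightarrow> ell1_norm \<beta>"
    unfolding A_def ell1_norm_def using summable_LIMSEQ[OF \<beta>] .
  ultimately have "(1 - \<delta>) * ell1_norm \<beta> \<le> B + (ell1_norm \<beta> - ell1_norm \<beta>)"
    by (intro LIMSEQ_le[OF tendsto_mult[OF tendsto_const A]
          tendsto_add[OF tendsto_const tendsto_diff[OF tendsto_const A]]]) auto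
  then show ?thesis
    by (simp add: B_def \<delta>_def)
qed

text \<open>For large \<open>N\<close> the map from coefficients to lacunary series is an isomorphism onto its image with
  constants \<open>1 - \<delta>\<close> and one, and a rescaling turns them into one and at most \<open>1 + \<epsilon>\<close>.\<close>

lemma almost_isometric_ell1_in_vanishing_pullbacks:
  assumes "vanishing_pullbacks \<subseteq> M \<union> {0}"
  shows "contains_almost_isometric_ell1 M"
  unfolding contains_almost_isometric_ell1_def
proof (intro allI impI)
  fix \<epsilon> :: real assume "0 < \<epsilon>"
  obtain N where N: "2 * pi * (1 + \<epsilon>) / \<epsilon> < real N"
    using reals_Archimedean2 by blast
  then have "0 < real N"
    using \<open>0 < \<epsilon>\<close> by (intro order_le_less_trans[OF _ N]) simp
  then have N0: "0 < N" by simp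
  define \<delta> where "\<delta> = 2 * pi / real N"
  define C where "C = 1 / (1 - \<delta>)"
  \<comment> \<open>The choice of \<open>N\<close> amounts to \<open>1 / (1 - \<delta>) \<le> 1 + \<epsilon>\<close>.\<close>
  have "2 * pi * (1 + \<epsilon>) < \<epsilon> * real N"
    using N \<open>0 < \<epsilon>\<close> by (simp add: pos_divide_less_eq mult.commute)
  then have \<delta>: "\<delta> * (1 + \<epsilon>) < \<epsilon>"
    using \<open>0 < real N\<close> by (simp add: \<delta>_def pos_divide_less_eq)
  then have "\<delta> * (1 + \<epsilon>) < 1 * (1 + \<epsilon>)"
    by simp
  then have "\<delta> < 1"
    using \<open>0 < \<epsilon>\<close> by (simp only: mult_less_cancel_right)
  have "0 < C" using \<open>\<delta> < 1\<close> by (simp add: C_def)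
  have "1 \<le> (1 + \<epsilon>) * (1 - \<delta>)"
    using \<delta> by (simp add: algebra_simps)
  then have C_le: "C \<le> 1 + \<epsilon>"
    using \<open>\<delta> < 1\<close> by (simp add: C_def pos_divide_le_eq)
  define T where "T \<beta> = complex_of_real C *\<^sub>C pullback (lacunary_series N \<beta>)" for \<beta>
  have hinf_fun_T: "hinf_fun (T \<beta>) = (\<lambda>x. if x \<in> ball 0 1 then C * lacunary_series N \<beta> (cayley_sum x) else 0)"
    if "\<beta> \<in> ell1" for \<beta>
    by (auto simp: T_def scaleC_hinf.rep_eq hinf_fun_pullback_lacunary N0 that)
  have Re_ge: "0 \<le> Re (cayley_sum x)" if "x \<in> ball 0 1" for x
    using cayley_sum_in_halfplane[OF that] by simp
  show "\<exists>T :: (nat \<Rightarrow> complex) \<Rightarrow> hinf.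
      (\<forall>\<beta>\<in>ell1. \<forall>\<gamma>\<in>ell1. T (\<lambda>n. \<beta> n + \<gamma> n) = T \<beta> + T \<gamma>) \<and>
      (\<forall>\<beta>\<in>ell1. \<forall>c. T (\<lambda>n. c * \<beta> n) = c *\<^sub>C T \<beta>) \<and>
      (\<forall>\<beta>\<in>ell1. ell1_norm \<beta> \<le> norm (T \<beta>) \<and> norm (T \<beta>) \<le> (1 + \<epsilon>) * ell1_norm \<beta>) \<and>
      T ` ell1 \<subseteq> M \<union> {0}"
  proof (intro exI[of _ T] conjI ballI allI)
    fix \<beta> \<gamma> assume \<beta>\<gamma>: "\<beta> \<in> ell1" "\<gamma> \<in> ell1"
    have sum: "(\<lambda>n. \<beta> n + \<gamma> n) \<in> ell1"
      unfolding ell1_def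
    proof (rule CollectI, rule summable_comparison_test')
      show "summable (\<lambda>n. norm (\<beta> n) + norm (\<gamma> n))"
        using \<beta>\<gamma> by (intro summable_add) (simp_all add: ell1_def)
    qed (simp add: norm_triangle_ineq)
    have "lacunary_series N (\<lambda>n. \<beta> n + \<gamma> n) s = lacunary_series N \<beta> s + lacunary_series N \<gamma> s"
      if "0 \<le> Re s" for s
      using sums_unique2[OF lacunary_series_sums[OF N0 sum that]]
        sums_add[OF lacunary_series_sums[OF N0 \<beta>\<gamma>(1) that] lacunary_series_sums[OF N0 \<beta>\<gamma>(2) that]]
      by (simp add: distrib_right)
    then show "T (\<lambda>n. \<beta> n + \<gamma> n) = T \<beta> + T \<gamma>"
      by (simp add: hinf_fun_inject[symmetric] plus_hinf.rep_eq hinf_fun_T \<beta>\<gamma> sum fun_eq_iff Re_ge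
          distrib_left)
  next
    fix \<beta> c assume \<beta>: "\<beta> \<in> ell1"
    have scaled: "(\<lambda>n. c * \<beta> n) \<in> ell1"
      using \<beta> by (simp add: ell1_def norm_mult summable_mult)
    have "lacunary_series N (\<lambda>n. c * \<beta> n) s = c * lacunary_series N \<beta> s" if "0 \<le> Re s" for s
      using sums_unique2[OF lacunary_series_sums[OF N0 scaled that]]
        sums_mult[OF lacunary_series_sums[OF N0 \<beta> that], of c]
      by (simp add: mult.assoc)
    then show "T (\<lambda>n. c * \<beta> n) = c *\<^sub>C T \<beta>"
      by (simp add: hinf_fun_inject[symmetric] scaleC_hinf.rep_eq hinf_fun_T \<beta> scaled fun_eq_iff Re_ge)
  next
    fix \<beta> assume \<beta>: "\<beta> \<in> ell1"
    have norm_T: "norm (T \<beta>) = C * norm (pullback (lacunary_series N \<beta>))"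
      using \<open>0 < C\<close> by (simp add: T_def norm_scaleC)
    have "ell1_norm \<beta> = C * ((1 - \<delta>) * ell1_norm \<beta>)"
      using \<open>\<delta> < 1\<close> by (simp add: C_def)
    also have "\<dots> \<le> norm (T \<beta>)"
      unfolding norm_T \<delta>_def using \<open>0 < C\<close> by (intro mult_left_mono norm_pullback_lacunary_ge N0 \<beta>) simp
    finally show "ell1_norm \<beta> \<le> norm (T \<beta>)" .
    have "norm (pullback (lacunary_series N \<beta>)) \<le> ell1_norm \<beta>"
      by (rule norm_hinf_least)
         (use N0 \<beta> Re_ge in \<open>simp add: hinf_fun_pullback_lacunary norm_lacunary_series_le_ell1\<close>)
    then show "norm (T \<beta>) \<le> (1 + \<epsilon>) * ell1_norm \<beta>"
      unfolding norm_T using C_le \<open>0 < \<epsilon>\<close> by (intro mult_mono) auto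
  next
    have "T ` ell1 \<subseteq> vanishing_pullbacks"
      unfolding T_def
      by (auto intro: complex_vector.subspace_scale[OF subspace_vanishing_pullbacks]
          pullback_lacunary_vanishing N0)
    then show "T ` ell1 \<subseteq> M \<union> {0}"
      using assms by (rule subset_trans)
  qed
qed

section \<open>Algebrability, the copy of absolutely summable sequences, and spaceability\<close>

theorem theorem1p4:
  defines "M \<equiv> {f :: hinf. \<forall>x \<in> ball (0 :: c0) 1. contains_disk (cluster_set f (linf_of_c0 x))}"
  shows "strongly_algebrable (UNIV :: real set) M
    \<and> contains_almost_isometric_ell1 M
    \<and> spaceable M"
proof (intro conjI)
  have sub: "vanishing_pullbacks \<subseteq> M \<union> {0}"
    using vanishing_pullback_disk by (auto simp: M_def)
  have eqpoll: "power_exponential ` {0<..<1} \<approx> (UNIV :: real set)"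
    using inj_on_image_eqpoll_self[OF inj_power_exponential] open_interval_eqpoll_reals[of 0 1]
      eqpoll_trans zero_less_one by blast
  then have infinite: "infinite (power_exponential ` {0<..<1})"
    using eqpoll_finite_iff infinite_UNIV_char_0 by blast
  show "strongly_algebrable (UNIV :: real set) M"
    unfolding strongly_algebrable_def
    using infinite eqpoll algebraically_independent_power_exponentials
      generated_subalgebra_power_exponentials sub by blast
  show "contains_almost_isometric_ell1 M"
    using sub by (rule almost_isometric_ell1_in_vanishing_pullbacks)
  show "spaceable M"
    unfolding spaceable_def
  proof (intro exI[of _ vanishing_pullbacks] conjI notI)
    assume "\<exists>B. finite B \<and> vanishing_pullbacks \<subseteq> complex_vector.span B"
    then obtain B where "finite B" "vanishing_pullbacks \<subseteq> complex_vector.span B" by blast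
    moreover have "power_exponential ` {0<..<1} \<subseteq> vanishing_pullbacks"
      using power_exponential_vanishing by blast
    ultimately show False
      using complex_vector.independent_span_bound[OF _ independent_power_exponentials] infinite by blast
  qed (fact subspace_vanishing_pullbacks closed_vanishing_pullbacks sub)+
qed

end
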